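(* Let $x\in \mathbb{C}\setminus((-\infty,-1]\cup[1,\infty))$ and let $\nu,\mu\in\mathbb{C}$ be such that $\nu+\mu\notin\{-1,-2,-3,\dots\}$. Put \[ u=x+i\sqrt{1-x^2},\qquad v=x-i\sqrt{1-x^2}=\frac1u. \] Then \[ \mathsf{P}_\nu^\mu(x)= \frac{2^\mu}{i\sqrt\pi}(1-x^2)^{\frac12\mu}\, \frac{\Gamma(\nu+\mu+1)}{\Gamma(\nu+\frac32)} \left(u^{\nu+\mu+1}\,{}_2F_1\!\left(\mu+\tfrac12,\nu+\mu+1;\nu+\tfrac32;\frac{u}{v}\right) -v^{\nu+\mu+1}\,{}_2F_1\!\left(\mu+\tfrac12,\nu+\mu+1;\nu+\tfrac32;\frac{v}{u}\right)\right). \]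
   Context: All square roots and complex powers are principal values (principal branch of the logarithm, $\arg\in(-\pi,\pi]$). ${}_2F_1(a,b;c;w)$ denotes the Gauss hypergeometric function, i.e. the analytic continuation to $w\in\mathbb{C}\setminus[1,\infty)$ (principal branch) of $\sum_{k=0}^\infty \frac{(a)_k(b)_k}{(c)_k k!}w^k$, $|w|<1$, where $(a)_k=a(a+1)\cdots(a+k-1)$ and $(a)_0=1$. The quotient $\frac{1}{\Gamma(c)}\,{}_2F_1(a,b;c;w)$ is understood as the regularized hypergeometric function, i.e. the analytic continuation to $w\in\mathbb{C}\setminus[1,\infty)$ of $\sum_{k=0}^\infty\frac{(a)_k(b)_k}{\Gamma(c+k)k!}w^k$, which is defined for all $c\in\mathbb{C}$ (with $1/\Gamma$ taken to be $0$ at the poles of $\Gamma$). The Ferrers function of the first kind is defined, for $\nu,\mu\in\mathbb{C}$ and $x\in\mathbb{C}\setminus((-\infty,-1]\cup[1,\infty))$, by \[ \mathsf{P}_\nu^\mu(x)=\left(\frac{1+x}{1-x}\right)^{\mu/2}\frac{1}{\Gamma(1-\mu)}\,{}_2F_1\!\left(\nu+1,-\nu;1-\mu;\tfrac{1-x}{2}\right). \] *)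

theory Defs
  imports "HOL-Complex_Analysis.Complex_Analysis"
begin

text \<open>
  The regularized Gauss hypergeometric function \<open>2F1(a,b;c;w) / \<Gamma>(c)\<close>: the holomorphic function on
  the plane cut along \<open>[1,\<infinity>)\<close> that is given by its Maclaurin series on the open unit disc.
  The cut plane is connected, so this continuation is unique there; values on the cut are unspecified.
  Since \<open>rGamma\<close> is the entire function \<open>1/\<Gamma>\<close>, with zeros at the poles of \<open>\<Gamma>\<close>,
  every complex \<open>c\<close> is allowed.
\<close>

definition hyp2F1_reg :: "complex \<Rightarrow> complex \<Rightarrow> complex \<Rightarrow> complex \<Rightarrow> complex" where
  "hyp2F1_reg a b c = (SOME f.
     f holomorphic_on (- complex_of_real ` {1..}) \<and>
     (\<forall>w\<in>ball 0 1.
        (\<lambda>k. pochhammer a k * pochhammer b k * rGamma (c + of_nat k) / fact k * w ^ k) sums f w))"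

definition ferrersP :: "complex \<Rightarrow> complex \<Rightarrow> complex \<Rightarrow> complex" where
  "ferrersP \<nu> \<mu> x =
     ((1 + x) / (1 - x)) powr (\<mu> / 2) * hyp2F1_reg (\<nu> + 1) (- \<nu>) (1 - \<mu>) ((1 - x) / 2)"

end

theory Submission
  imports Defs
begin

text \<open>
  Put \<open>x = cos \<theta>\<close> with \<open>0 < Re \<theta> < \<pi>\<close>. Then \<open>u = exp (\<i> \<theta>)\<close>, \<open>v = exp (- \<i> \<theta>)\<close> and the principal powers in the
  statement become exponentials (\<open>cos_parametrisation\<close>, \<open>ferrersP_cos\<close>). After division by \<open>(sin \<theta>) powr \<mu>\<close> both
  sides solve the Gegenbauer equation
  \<open>y'' + (2 \<mu> + 1) cot \<theta> y' + (\<nu> - \<mu>) (\<nu> + \<mu> + 1) y = 0\<close>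
  on the strip: for each of the three terms this is the hypergeometric equation in a suitable variable, \<open>(1 - x)/2\<close> on
  the left and \<open>u/v\<close>, \<open>v/u\<close> on the right (\<open>half_angle_solution_derivs\<close>, \<open>fourier_solution_derivs\<close>). A
  solution on the connected strip is determined by its value and derivative at one point
  (\<open>linear_ode2_unique\<close>), so it suffices to compare these at \<open>\<theta> = \<pi>/2\<close>, that is, at \<open>x = 0\<close>.

  At this point the hypergeometric functions are evaluated at \<open>1/2\<close> on the left and at \<open>-1\<close> on the right. The parameters
  are those of the classical theorems of Bailey (\<open>hyp2F1_reg_half\<close>) and Kummer (\<open>hyp2F1_reg_minus_one\<close>), and Pfaff's
  transformation (\<open>hyp2F1_reg_pfaff\<close>) reduces the second to the first. Bailey's theorem itself follows from a
  recurrence in the third parameter, together with the limit as that parameter tends to infinity. The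
  derivatives lead to Bailey's theorem again, with the third parameter lowered by one. What remains is an identity
  between Gamma functions, a consequence of the duplication and reflection formulas (\<open>solutions_agree_at_half_pi\<close>).

  All this presupposes that the continuation of the regularized series to the cut plane exists
  for arbitrary parameters (\<open>ex_hyp_continuation\<close>). Euler's integral gives it for \<open>Re b > 1\<close> and \<open>Re (c - b) > 1\<close>, and
  contiguous relations extend it to all \<open>b\<close> and \<open>c\<close>. Identities between these functions are verified
  on power series coefficients and carried to the cut plane by the identity theorem (\<open>eq_on_cut_plane\<close>).
\<close>

section \<open>The cut plane\<close>

definition cut_plane :: "complex set" where
  "cut_plane = - complex_of_real ` {1..}"

lemma open_cut_plane: "open cut_plane"
proof -
  have "closed (complex_of_real ` {1..})"
    by (intro closed_injective_linear_image) (auto intro: linearI simp: inj_on_def scaleR_conv_of_real algebra_simps)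
  thus ?thesis by (auto simp: cut_plane_def)
qed

text \<open>
  This is the form in which the branch cut is met: \<open>1 - w\<close> is the base of the principal powers
  \<open>(1 - w) powr s\<close>, which are holomorphic off the nonpositive reals.
\<close>

lemma cut_plane_iff: "w \<in> cut_plane \<longleftrightarrow> 1 - w \<notin> \<real>\<^sub>\<le>\<^sub>0"
proof -
  have "w \<in> complex_of_real ` {1..} \<longleftrightarrow> Im w = 0 \<and> Re w \<ge> 1"
    by (auto simp: image_iff complex_eq_iff intro!: bexI[of _ "Re w"])
  thus ?thesis by (auto simp: cut_plane_def complex_nonpos_Reals_iff)
qed

lemma cut_plane_iff': "w \<in> cut_plane \<longleftrightarrow> Im w \<noteq> 0 \<or> Re w < 1"
  unfolding cut_plane_iff by (auto simp: complex_nonpos_Reals_iff)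

text \<open>
  The cut plane is starlike about the origin. Besides connectedness this gives the integrand of Euler's
  integral, in which \<open>t * w\<close> with \<open>0 \<le> t \<le> 1\<close> takes the place of \<open>w\<close>.
\<close>

lemma scaled_in_cut_plane:
  assumes "w \<in> cut_plane" "0 \<le> t" "t \<le> (1::real)"
  shows "of_real t * w \<in> cut_plane"
proof (rule ccontr)
  assume "\<not> ?thesis"
  hence *: "t * Im w = 0" "t * Re w \<ge> 1"
    by (simp_all add: cut_plane_iff')
  moreover have "t \<noteq> 0" using *(2) by auto
  ultimately have t: "t > 0" "Im w = 0"
    using assms(2) by simp_all
  hence "Re w > 0"
    using *(2) zero_less_mult_pos[of t "Re w"] by simp
  hence "t * Re w \<le> 1 * Re w"
    using assms(3) by (intro mult_right_mono) simp_all
  thus False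
    using * t assms(1) by (simp add: cut_plane_iff')
qed

lemma connected_cut_plane: "connected cut_plane"
proof (rule starlike_imp_connected)
  show "starlike cut_plane"
    unfolding starlike_def
  proof (rule bexI[of _ 0], rule ballI)
    fix w assume "w \<in> cut_plane"
    thus "closed_segment 0 w \<subseteq> cut_plane"
      using scaled_in_cut_plane[of w] by (auto simp: closed_segment_def scaleR_conv_of_real)
  qed (simp add: cut_plane_iff')
qed

lemma ball_subset_cut_plane: "ball 0 1 \<subseteq> cut_plane"
proof
  fix w :: complex assume "w \<in> ball 0 1"
  thus "w \<in> cut_plane"
    using complex_Re_le_cmod[of w] by (simp add: cut_plane_iff')
qed

lemma zero_in_cut_plane: "0 \<in> cut_plane"
  by (simp add: cut_plane_iff')

text \<open>
  The identity theorem in the form used throughout: an identity between holomorphic functions on the cut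
  plane reduces to an identity between formal power series at the origin, that is, to coefficient algebra.
\<close>

lemma eq_on_cut_plane:
  assumes "f holomorphic_on cut_plane" "g holomorphic_on cut_plane"
    and "f has_fps_expansion F" "g has_fps_expansion F" "w \<in> cut_plane"
  shows "f w = g w"
proof -
  have "(\<lambda>w. f w - g w) has_fps_expansion F - F"
    by (intro fps_expansion_intros assms)
  hence "f w - g w = 0"
    using has_fps_expansion_0_analytic_continuation[of "\<lambda>w. f w - g w" cut_plane w]
      assms open_cut_plane connected_cut_plane zero_in_cut_plane
    by (auto intro: holomorphic_intros)
  thus ?thesis by simp
qed

definition hyp_fps :: "complex \<Rightarrow> complex \<Rightarrow> complex \<Rightarrow> complex fps" where
  "hyp_fps a b c = Abs_fps (\<lambda>k. pochhammer a k * pochhammer b k * rGamma (c + of_nat k) / fact k)"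

text \<open>
  The property that the choice operator in the definition of \<^const>\<open>hyp2F1_reg\<close> selects for, with
  summation on the unit disc replaced by the equivalent, but more easily manipulated, existence of
  a power series expansion at the origin.
\<close>

definition hyp_continuation :: "complex \<Rightarrow> complex \<Rightarrow> complex \<Rightarrow> (complex \<Rightarrow> complex) \<Rightarrow> bool" where
  "hyp_continuation a b c f \<longleftrightarrow> f holomorphic_on cut_plane \<and> f has_fps_expansion hyp_fps a b c"

text \<open>
  Holomorphy on the whole unit disc, which lies in the cut plane, makes an expansion that is valid near the
  origin converge on the disc.
\<close>

lemma hyp_continuation_sums:
  assumes "hyp_continuation a b c f" "w \<in> ball 0 1"
  shows "(\<lambda>k. pochhammer a k * pochhammer b k * rGamma (c + of_nat k) / fact k * w ^ k) sums f w"
proof -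
  have "f holomorphic_on eball 0 (ereal 1)"
    using holomorphic_on_subset[OF _ ball_subset_cut_plane, of f] assms(1)
    by (simp add: hyp_continuation_def)
  from has_fps_expansion_imp_sums_complex[OF _ this, of "hyp_fps a b c" w] show ?thesis
    using assms by (simp add: hyp_continuation_def hyp_fps_def)
qed

lemma hyp_continuation_iff:
  "hyp_continuation a b c f \<longleftrightarrow> f holomorphic_on cut_plane \<and>
     (\<forall>w\<in>ball 0 1.
        (\<lambda>k. pochhammer a k * pochhammer b k * rGamma (c + of_nat k) / fact k * w ^ k) sums f w)"
  (is "_ \<longleftrightarrow> _ \<and> ?S")
proof (intro iffI conjI)
  assume "f holomorphic_on cut_plane \<and> ?S"
  moreover from this have "f has_fps_expansion hyp_fps a b c"
    by (intro has_fps_expansionI eventually_mono[OF eventually_nhds_in_open[of "ball 0 1" 0]])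
       (simp_all add: hyp_fps_def)
  ultimately show "hyp_continuation a b c f"
    by (simp add: hyp_continuation_def)
next
  assume f: "hyp_continuation a b c f"
  thus "f holomorphic_on cut_plane" by (simp add: hyp_continuation_def)
  show ?S using hyp_continuation_sums[OF f] by blast
qed

section \<open>Euler's integral\<close>

text \<open>
  By the Weierstrass theorem \<open>\<phi>\<close> is a uniform limit of polynomials, all of which are orthogonal to it;
  so \<open>\<phi>\<close> is orthogonal to itself.
\<close>

lemma moments_determine_zero:
  fixes \<phi> :: "real \<Rightarrow> real"
  assumes cont: "continuous_on {0..1} \<phi>"
    and mom: "\<And>k::nat. integral {0..1} (\<lambda>t. t ^ k * \<phi> t) = 0"
    and t: "t \<in> {0..1}"
  shows "\<phi> t = 0"
proof -
  have int: "(\<lambda>t. f t) integrable_on {0..1}" if "continuous_on {0..1} f" for f :: "real \<Rightarrow> real"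
    using that by (rule integrable_continuous_real)
  define M where "M = integral {0..1} (\<lambda>t. \<bar>\<phi> t\<bar>)"
  have M: "M \<ge> 0"
    unfolding M_def by (intro integral_nonneg int continuous_intros cont) auto
  have "integral {0..1} (\<lambda>t. \<phi> t * \<phi> t) \<le> e" if "e > 0" for e
  proof -
    \<comment> \<open>The accuracy is chosen so that the error \<open>d * M\<close> stays below \<open>e\<close>.\<close>
    define d where "d = e / (M + 1)"
    have d: "d > 0" using that M by (simp add: d_def)
    obtain g where g: "real_polynomial_function g" "\<And>x. x \<in> {0..1} \<Longrightarrow> \<bar>\<phi> x - g x\<bar> < d"
      using Stone_Weierstrass_real_polynomial_function[OF compact_Icc cont d] by metis
    obtain a n where gsum: "g = (\<lambda>x. \<Sum>i\<le>n. a i * x ^ i)"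
      using g(1) by (auto simp: real_polynomial_function_iff_sum)
    have contg: "continuous_on {0..1} g"
      unfolding gsum by (intro continuous_intros)
    have "integral {0..1} (\<lambda>t. g t * \<phi> t) = integral {0..1} (\<lambda>t. \<Sum>i\<le>n. a i * (t ^ i * \<phi> t))"
      unfolding gsum by (simp add: sum_distrib_right mult.assoc)
    also have "\<dots> = (\<Sum>i\<le>n. integral {0..1} (\<lambda>t. a i * (t ^ i * \<phi> t)))"
      by (intro integral_sum int continuous_intros cont) auto
    also have "\<dots> = 0"
      using mom by simp
    finally have g0: "integral {0..1} (\<lambda>t. g t * \<phi> t) = 0" .
    have "integral {0..1} (\<lambda>t. \<phi> t * \<phi> t) = integral {0..1} (\<lambda>t. (\<phi> t - g t) * \<phi> t + g t * \<phi> t)"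
      by (simp add: algebra_simps)
    also have "\<dots> = integral {0..1} (\<lambda>t. (\<phi> t - g t) * \<phi> t)"
      using g0 by (subst integral_add) (auto intro!: int continuous_intros cont contg)
    also have "\<dots> \<le> integral {0..1} (\<lambda>t. d * \<bar>\<phi> t\<bar>)"
    proof (intro integral_le int continuous_intros cont contg)
      fix x :: real assume "x \<in> {0..1}"
      have "(\<phi> x - g x) * \<phi> x \<le> \<bar>\<phi> x - g x\<bar> * \<bar>\<phi> x\<bar>"
        by (metis abs_ge_self abs_mult)
      also have "\<dots> \<le> d * \<bar>\<phi> x\<bar>"
        using g(2)[OF \<open>x \<in> _\<close>] by (intro mult_right_mono) auto
      finally show "(\<phi> x - g x) * \<phi> x \<le> d * \<bar>\<phi> x\<bar>" .
    qed
    also have "\<dots> = d * M" by (simp add: M_def)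
    also have "\<dots> \<le> e" using M that by (simp add: d_def field_simps)
    finally show ?thesis .
  qed
  hence "integral {0..1} (\<lambda>t. \<phi> t * \<phi> t) \<le> 0"
    using field_le_epsilon[of "integral {0..1} (\<lambda>t. \<phi> t * \<phi> t)" 0] by simp
  moreover have "integral {0..1} (\<lambda>t. \<phi> t * \<phi> t) \<ge> 0"
    by (intro integral_nonneg int continuous_intros cont) auto
  ultimately have "integral {0..1} (\<lambda>t. \<phi> t * \<phi> t) = 0" by simp
  hence "((\<lambda>t. \<phi> t * \<phi> t) has_integral 0) (cbox 0 1)"
    using int[of "\<lambda>t. \<phi> t * \<phi> t"] cont by (auto simp: has_integral_integral intro!: continuous_intros)
  hence "\<phi> t * \<phi> t = 0"
    using t cont
    by (intro has_integral_0_cbox_imp_0[of 0 1 "\<lambda>t. \<phi> t * \<phi> t"]) (auto intro!: continuous_intros)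
  thus ?thesis by simp
qed

lemma complex_moments_determine_zero:
  fixes \<phi> :: "real \<Rightarrow> complex"
  assumes cont: "continuous_on {0..1} \<phi>"
    and mom: "\<And>k::nat. integral {0..1} (\<lambda>t. of_real t ^ k * \<phi> t) = 0"
    and t: "t \<in> {0..1}"
  shows "\<phi> t = 0"
proof -
  have I: "((\<lambda>t. of_real t ^ k * \<phi> t) has_integral 0) {0..1}" for k :: nat
  proof -
    have "(\<lambda>t. of_real t ^ k * \<phi> t) integrable_on {0..1}"
      by (intro integrable_continuous_real continuous_intros cont)
    thus ?thesis using mom[of k] by (simp add: has_integral_integral)
  qed
  have "Re (\<phi> t) = 0"
  proof (rule moments_determine_zero[of "\<lambda>t. Re (\<phi> t)"])
    fix k :: nat
    show "integral {0..1} (\<lambda>t. t ^ k * Re (\<phi> t)) = 0"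
      using has_integral_linear[OF I[of k] bounded_linear_Re]
      by (auto simp: o_def simp flip: of_real_power intro!: integral_unique)
  qed (use t in \<open>auto intro!: continuous_intros cont\<close>)
  moreover have "Im (\<phi> t) = 0"
  proof (rule moments_determine_zero[of "\<lambda>t. Im (\<phi> t)"])
    fix k :: nat
    show "integral {0..1} (\<lambda>t. t ^ k * Im (\<phi> t)) = 0"
      using has_integral_linear[OF I[of k] bounded_linear_Im]
      by (auto simp: o_def simp flip: of_real_power intro!: integral_unique)
  qed (use t in \<open>auto intro!: continuous_intros cont\<close>)
  ultimately show ?thesis by (simp add: complex_eq_iff)
qed

lemma pochhammer_nonzero_right_half_plane:
  fixes c :: complex
  assumes "Re c > 0"
  shows "pochhammer c k \<noteq> 0"
proof
  assume "pochhammer c k = 0"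
  then obtain n where "c = - of_nat n" by (auto simp: pochhammer_eq_0_iff)
  thus False using assms by simp
qed

text \<open>
  The kernel of Euler's integral. Integrating the derivative of \<open>t powr (b + k) * (1 - t) powr (c - b)\<close>, which
  vanishes at both ends of the interval, relates consecutive moments, so that the \<open>k\<close>-th moment is
  \<open>(b)\<^sub>k / (c)\<^sub>k\<close> times the zeroth. If the zeroth moment were \<open>0\<close>, all moments would be, and the kernel would vanish
  identically; so no evaluation of the Beta integral is called for. The bounds \<open>Re b > 1\<close> and \<open>Re (c - b) > 1\<close> make
  the kernel continuous on the closed interval.
\<close>

lemma euler_kernel_moments:
  fixes b c :: complex
  assumes "Re b > 1" "Re (c - b) > 1"
  defines "\<phi> \<equiv> (\<lambda>t::real. of_real t powr (b - 1) * of_real (1 - t) powr (c - b - 1))"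
  defines "m \<equiv> (\<lambda>k::nat. integral {0..1} (\<lambda>t. of_real t ^ k * \<phi> t))"
  shows "continuous_on {0..1} \<phi>" and "m k * pochhammer c k = m 0 * pochhammer b k"
    and "m 0 \<noteq> 0"
proof -
  show cont: "continuous_on {0..1} \<phi>"
    unfolding \<phi>_def using assms(1,2) by (intro continuous_intros) auto
  have int: "(\<lambda>t. of_real t ^ k * \<phi> t) integrable_on {0..1}" for k
    by (intro integrable_continuous_real continuous_intros cont)
  have step: "(c + of_nat k) * m (Suc k) = (b + of_nat k) * m k" for k :: nat
  proof -
    \<comment> \<open>An antiderivative that vanishes at both end points.\<close>
    define G where "G = (\<lambda>t::real. complex_of_real t powr (b + of_nat k) * of_real (1 - t) powr (c - b))"
    have "((\<lambda>t. (b + of_nat k) * (of_real t ^ k * \<phi> t) - (c + of_nat k) * (of_real t ^ Suc k * \<phi> t))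
            has_integral (G 1 - G 0)) {0..1}" (is "(?h has_integral _) _")
    proof (rule fundamental_theorem_of_calculus_interior)
      show "continuous_on {0..1} G"
        unfolding G_def using assms(1,2) by (intro continuous_intros) auto
      fix t :: real assume t: "t \<in> {0<..<1}"
      have nz: "complex_of_real t \<notin> \<real>\<^sub>\<le>\<^sub>0" "complex_of_real (1 - t) \<notin> \<real>\<^sub>\<le>\<^sub>0"
        using t by (simp_all only: nonpos_Reals_of_real_iff) auto
      have nz': "of_real t \<noteq> (0::complex)" "complex_of_real (1 - t) \<noteq> 0"
        using t by (simp_all only: of_real_eq_0_iff) auto
      define T where "T = complex_of_real t powr (b - 1)"
      define S where "S = complex_of_real (1 - t) powr (c - b - 1)"
      have pT: "complex_of_real t powr (b + of_nat k) = of_real t ^ Suc k * T"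
        "complex_of_real t powr (b + of_nat k - 1) = of_real t ^ k * T"
      proof -
        have "complex_of_real t powr (b + of_nat k) = of_real t powr ((b - 1) + of_nat (Suc k))"
          by (simp add: algebra_simps)
        also have "\<dots> = of_real t ^ Suc k * T"
          using nz' unfolding T_def by (subst powr_add) (simp add: powr_nat' del: of_nat_Suc power_Suc)
        finally show "complex_of_real t powr (b + of_nat k) = of_real t ^ Suc k * T" .
        have "complex_of_real t powr (b + of_nat k - 1) = of_real t powr ((b - 1) + of_nat k)"
          by (simp add: algebra_simps)
        also have "\<dots> = of_real t ^ k * T"
          using nz' unfolding T_def by (subst powr_add) (simp add: powr_nat')
        finally show "complex_of_real t powr (b + of_nat k - 1) = of_real t ^ k * T" .
      qed
      have pS: "complex_of_real (1 - t) powr (c - b) = of_real (1 - t) * S"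
      proof -
        have "complex_of_real (1 - t) powr (c - b) = complex_of_real (1 - t) powr ((c - b - 1) + 1)"
          by simp
        also have "\<dots> = of_real (1 - t) * S"
          using nz' unfolding S_def by (subst powr_add) simp
        finally show ?thesis .
      qed
      have "((\<lambda>z. z powr (b + of_nat k) * (1 - z) powr (c - b)) has_field_derivative
              (b + of_nat k) * of_real t powr (b + of_nat k - 1) * (1 - of_real t) powr (c - b) -
              (c - b) * (1 - of_real t) powr (c - b - 1) * of_real t powr (b + of_nat k)) (at (complex_of_real t))"
        using nz by (auto intro!: derivative_eq_intros)
      hence "((\<lambda>z. z powr (b + of_nat k) * (1 - z) powr (c - b)) has_field_derivative
              (b + of_nat k) * (of_real t ^ k * \<phi> t) - (c + of_nat k) * (of_real t ^ Suc k * \<phi> t))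
              (at (complex_of_real t))"
      proof (rule DERIV_cong)
        show "(b + of_nat k) * of_real t powr (b + of_nat k - 1) * (1 - of_real t) powr (c - b) -
              (c - b) * (1 - of_real t) powr (c - b - 1) * of_real t powr (b + of_nat k)
            = (b + of_nat k) * (of_real t ^ k * \<phi> t) - (c + of_nat k) * (of_real t ^ Suc k * \<phi> t)"
        proof -
          have "(1 - complex_of_real t) powr (c - b) = (1 - of_real t) * S"
               "(1 - complex_of_real t) powr (c - b - 1) = S"
            using pS by (simp_all add: S_def)
          moreover have "\<phi> t = T * S" by (simp add: \<phi>_def T_def S_def)
          ultimately show ?thesis by (simp only: pT) (simp add: algebra_simps)
        qed
      qed
      hence "((\<lambda>t. (\<lambda>z. z powr (b + of_nat k) * (1 - z) powr (c - b)) (of_real t)) has_vector_derivative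
              (b + of_nat k) * (of_real t ^ k * \<phi> t) - (c + of_nat k) * (of_real t ^ Suc k * \<phi> t)) (at t)"
        by (rule has_vector_derivative_real_field)
      thus "(G has_vector_derivative
              (b + of_nat k) * (of_real t ^ k * \<phi> t) - (c + of_nat k) * (of_real t ^ Suc k * \<phi> t)) (at t)"
        by (simp add: G_def)
    qed auto
    moreover have "(?h has_integral ((b + of_nat k) * m k - (c + of_nat k) * m (Suc k))) {0..1}"
      unfolding m_def by (intro has_integral_diff has_integral_mult_right integrable_integral int)
    ultimately have "G 1 - G 0 = (b + of_nat k) * m k - (c + of_nat k) * m (Suc k)"
      by (rule has_integral_unique)
    moreover have "G 1 = 0" "G 0 = 0" using assms(1,2) by (auto simp: G_def)
    ultimately show ?thesis by simp
  qed
  show mk: "m k * pochhammer c k = m 0 * pochhammer b k" for k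
  proof (induction k)
    case (Suc k)
    have "m (Suc k) * pochhammer c (Suc k) = ((c + of_nat k) * m (Suc k)) * pochhammer c k"
      by (simp add: pochhammer_Suc mult_ac)
    also have "\<dots> = (b + of_nat k) * (m k * pochhammer c k)"
      by (simp only: step mult.assoc)
    finally show ?case by (simp add: Suc.IH pochhammer_Suc mult_ac)
  qed auto
  show "m 0 \<noteq> 0"
  proof
    assume "m 0 = 0"
    have "m k = 0" for k
    proof -
      have "pochhammer c k \<noteq> 0"
        using assms(1,2) by (intro pochhammer_nonzero_right_half_plane) simp
      thus ?thesis using mk[of k] \<open>m 0 = 0\<close> by simp
    qed
    hence "\<phi> (1/2) = 0"
      by (intro complex_moments_determine_zero[OF cont]) (auto simp: m_def)
    thus False by (simp add: \<phi>_def)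
  qed
qed

lemma binomial_series_pochhammer:
  fixes z a :: complex
  assumes "norm z < 1"
  shows "(\<lambda>k. pochhammer a k / fact k * z ^ k) sums ((1 - z) powr (- a))"
proof -
  have "(\<lambda>k. ((- a) gchoose k) * (- z) ^ k) sums (1 + (- z)) powr (- a)"
    using assms by (intro gen_binomial_complex) auto
  also have "(\<lambda>k. ((- a) gchoose k) * (- z) ^ k) = (\<lambda>k. pochhammer a k / fact k * z ^ k)"
  proof
    fix k
    have "(- z) ^ k = (- 1) ^ k * z ^ k" "(- 1) ^ k * (- 1) ^ k = (1 :: complex)"
      by (rule power_minus, simp flip: power_mult_distrib)
    thus "((- a) gchoose k) * (- z) ^ k = pochhammer a k / fact k * z ^ k"
      by (simp add: gbinomial_pochhammer)
  qed
  finally show ?thesis by simp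
qed

text \<open>
  Euler's integral \<open>\<integral> \<phi>(t) (1 - t w) powr (- a) dt\<close> is holomorphic in \<open>w\<close> on the cut plane, because the base of the
  power never meets the branch cut. Expanding the power by the binomial series and integrating term by term
  turns the moments of the kernel into the coefficients of the hypergeometric series.
\<close>

lemma euler_integral_continuation:
  fixes a b c :: complex
  assumes "Re b > 1" "Re (c - b) > 1"
  shows "\<exists>f. hyp_continuation a b c f"
proof -
  define \<phi> where "\<phi> = (\<lambda>t::real. complex_of_real t powr (b - 1) * of_real (1 - t) powr (c - b - 1))"
  define m where "m = (\<lambda>k::nat. integral {0..1} (\<lambda>t. of_real t ^ k * \<phi> t))"
  have cont: "continuous_on {0..1} \<phi>"
    unfolding \<phi>_def by (rule euler_kernel_moments(1)[OF assms])
  have mk: "m k * pochhammer c k = m 0 * pochhammer b k" for k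
    unfolding m_def \<phi>_def by (rule euler_kernel_moments(2)[OF assms])
  have m0: "m 0 \<noteq> 0"
    unfolding m_def \<phi>_def by (rule euler_kernel_moments(3)[OF assms])
  have nonpos: "1 - of_real t * w \<notin> \<real>\<^sub>\<le>\<^sub>0" if "w \<in> cut_plane" "t \<in> {0..1}" for w t
    using scaled_in_cut_plane[of w t] that by (simp add: cut_plane_iff)
  have base: "Re (1 - of_real t * w) \<ge> 0 \<or> Im (1 - of_real t * w) \<noteq> 0" "1 - of_real t * w \<noteq> 0"
    if "w \<in> cut_plane" "t \<in> {0..1}" for w t
  proof -
    show "Re (1 - of_real t * w) \<ge> 0 \<or> Im (1 - of_real t * w) \<noteq> 0"
      using nonpos[OF that] unfolding complex_nonpos_Reals_iff by linarith
    show "1 - of_real t * w \<noteq> 0"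
      using nonpos[OF that] by (metis nonpos_Reals_zero_I)
  qed
  define I where "I = (\<lambda>w. integral {0..1} (\<lambda>t. \<phi> t * (1 - of_real t * w) powr (- a)))"
  have hol: "I holomorphic_on cut_plane"
    unfolding holomorphic_on_def
  proof
    fix w assume "w \<in> cut_plane"
    then obtain e where e: "e > 0" "ball w e \<subseteq> cut_plane"
      using open_cut_plane open_contains_ball by blast
    have "(\<lambda>z. integral (cbox 0 1) (\<lambda>t. \<phi> t * (1 - of_real t * z) powr (- a))) holomorphic_on ball w e"
    proof (rule leibniz_rule_holomorphic)
      fix z and t :: real assume z: "z \<in> ball w e" and t: "t \<in> cbox 0 1"
      hence "1 - of_real t * z \<notin> \<real>\<^sub>\<le>\<^sub>0"
        using nonpos[of z t] e by auto
      thus "((\<lambda>z. \<phi> t * (1 - of_real t * z) powr (- a)) has_field_derivative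
              (\<phi> t * (a * of_real t * (1 - of_real t * z) powr (- a - 1)))) (at z within ball w e)"
        by (auto intro!: derivative_eq_intros)
    next
      fix z assume z: "z \<in> ball w e"
      have "continuous_on {0..1} (\<lambda>t. (1 - of_real t * z) powr (- a))"
        by (intro continuous_on_powr_complex continuous_intros subsetI CollectI)
           (use base[of z] z e in \<open>blast+\<close>)
      thus "(\<lambda>t. \<phi> t * (1 - of_real t * z) powr (- a)) integrable_on cbox 0 1"
        unfolding cbox_interval by (intro integrable_continuous_real continuous_on_mult cont)
    next
      have 1: "continuous_on (ball w e \<times> {0..1}) (\<lambda>p. \<phi> (snd p))"
        by (rule continuous_on_compose2[OF cont]) (auto intro: continuous_intros)
      have 2: "continuous_on (ball w e \<times> {0..1}) (\<lambda>p. (1 - of_real (snd p) * fst p) powr (- a - 1))"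
      proof (rule continuous_on_powr_complex)
        have p: "fst p \<in> cut_plane" "snd p \<in> {0..1}" if "p \<in> ball w e \<times> {0..1}" for p
          using e that by (auto simp only: mem_Times_iff)
        show "ball w e \<times> {0..1} \<subseteq> {p. 0 \<le> Re (1 - of_real (snd p) * fst p) \<or> Im (1 - of_real (snd p) * fst p) \<noteq> 0}"
          by (rule subsetI, rule CollectI, rule base(1)[OF p])
        show "Re (- a - 1) > 0" if "p \<in> ball w e \<times> {0..1}" "1 - of_real (snd p) * fst p = 0" for p :: "complex \<times> real"
          using base(2)[OF p[OF that(1)]] that(2) by contradiction
      qed (intro continuous_intros)+
      have "continuous_on (ball w e \<times> {0..1})
              (\<lambda>p. \<phi> (snd p) * (a * of_real (snd p) * (1 - of_real (snd p) * fst p) powr (- a - 1)))"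
        by (intro continuous_on_mult continuous_on_const continuous_on_of_real continuous_on_snd continuous_on_id 1 2)
      thus "continuous_on (ball w e \<times> cbox 0 1)
              (\<lambda>(z, t). \<phi> t * (a * of_real t * (1 - of_real t * z) powr (- a - 1)))"
        by (simp add: case_prod_unfold)
    qed auto
    hence "I holomorphic_on ball w e"
      by (simp add: I_def[abs_def])
    hence "I field_differentiable (at w)"
      using e by (auto simp: holomorphic_on_open field_differentiable_def)
    thus "I field_differentiable (at w within cut_plane)"
      by (rule field_differentiable_at_within)
  qed
  have sums: "(\<lambda>k. pochhammer a k / fact k * w ^ k * m k) sums I w" if w: "norm w < 1" for w
  proof -
    define g where "g = (\<lambda>k t. \<phi> t * (pochhammer a k / fact k * (of_real t * w) ^ k))"
    have "bounded (\<phi> ` {0..1})"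
      by (intro compact_imp_bounded compact_continuous_image cont) auto
    then obtain B where "\<forall>z\<in>\<phi> ` {0..1}. norm z \<le> B"
      unfolding bounded_iff by blast
    hence B: "norm (\<phi> t) \<le> B" if "t \<in> {0..1}" for t
      using that by (rule bspec[OF _ imageI])
    have B0: "B \<ge> 0" by (rule order_trans[OF norm_ge_zero B[of 0]]) simp
    obtain r where r: "norm w < r" "r < 1" using dense[OF w] by blast
    have r0: "r > 0" by (rule le_less_trans[OF norm_ge_zero r(1)])
    have "summable (\<lambda>k. norm (pochhammer a k / fact k * w ^ k))"
    proof (rule powser_insidea)
      have "norm (complex_of_real r) < 1" using r r0 by simp
      from sums_summable[OF binomial_series_pochhammer[OF this]]
      show "summable (\<lambda>k. pochhammer a k / fact k * complex_of_real r ^ k)" .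
      show "norm w < norm (complex_of_real r)"
        using r r0 by simp
    qed
    hence summ: "summable (\<lambda>k. B * norm (pochhammer a k / fact k * w ^ k))"
      by (rule summable_mult)
    have "uniform_limit {0..1} (\<lambda>n t. \<Sum>k<n. g k t) (\<lambda>t. \<Sum>k. g k t) sequentially"
    proof (rule Weierstrass_m_test[OF _ summ])
      fix k and t :: real assume t: "t \<in> {0..1}"
      have "norm (of_real t * w) ^ k \<le> norm w ^ k"
        using t by (intro power_mono) (auto simp: norm_mult mult_left_le_one_le)
      hence "norm (pochhammer a k / fact k * (of_real t * w) ^ k) \<le> norm (pochhammer a k / fact k * w ^ k)"
        unfolding norm_mult[of "pochhammer a k / fact k"] norm_power[of w] norm_power[of "_ * w"]
        by (intro mult_left_mono norm_ge_zero)
      thus "norm (g k t) \<le> B * norm (pochhammer a k / fact k * w ^ k)"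
        unfolding g_def norm_mult[of "\<phi> t"] using B[OF t] B0 by (intro mult_mono) auto
    qed
    moreover have "(\<Sum>k. g k t) = \<phi> t * (1 - of_real t * w) powr (- a)" if t: "t \<in> {0..1}" for t
    proof -
      have "norm (of_real t * w) \<le> 1 * norm w"
        using t unfolding norm_mult by (intro mult_right_mono) auto
      with w have "norm (of_real t * w) < 1" by linarith
      hence "(\<lambda>k. g k t) sums (\<phi> t * (1 - of_real t * w) powr (- a))"
        unfolding g_def by (intro sums_mult binomial_series_pochhammer)
      thus ?thesis by (rule sums_unique[symmetric])
    qed
    ultimately have ul: "uniform_limit {0..1} (\<lambda>n t. \<Sum>k<n. g k t)
        (\<lambda>t. \<phi> t * (1 - of_real t * w) powr (- a)) sequentially"
      using uniform_limit_cong'[of "{0..1}" "\<lambda>n t. \<Sum>k<n. g k t" "\<lambda>n t. \<Sum>k<n. g k t"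
              "\<lambda>t. \<Sum>k. g k t" "\<lambda>t. \<phi> t * (1 - of_real t * w) powr (- a)"] by blast
    have contg: "continuous_on {0..1} (g k)" for k
      unfolding g_def by (intro continuous_intros cont)
    obtain J L where JL: "\<And>n. ((\<lambda>t. \<Sum>k<n. g k t) has_integral J n) {0..1}"
      "((\<lambda>t. \<phi> t * (1 - of_real t * w) powr (- a)) has_integral L) {0..1}" "J \<longlonglongrightarrow> L"
      by (rule uniform_limit_integral[OF ul]) (auto intro!: continuous_intros contg)
    have J: "J n = (\<Sum>k<n. pochhammer a k / fact k * w ^ k * m k)" for n
    proof -
      have "J n = integral {0..1} (\<lambda>t. \<Sum>k<n. g k t)"
        by (rule integral_unique[OF JL(1), symmetric])
      also have "\<dots> = (\<Sum>k<n. integral {0..1} (g k))"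
        by (rule integral_sum) (simp_all add: integrable_continuous_real[OF contg])
      also have "\<dots> = (\<Sum>k<n. pochhammer a k / fact k * w ^ k * m k)"
      proof (intro sum.cong refl)
        fix k
        have "g k = (\<lambda>t. (pochhammer a k / fact k * w ^ k) * (of_real t ^ k * \<phi> t))"
          by (simp add: g_def fun_eq_iff power_mult_distrib mult_ac)
        thus "integral {0..1} (g k) = pochhammer a k / fact k * w ^ k * m k"
          by (simp add: m_def)
      qed
      finally show ?thesis .
    qed
    have "I w = L"
      unfolding I_def using JL(2) by (rule integral_unique)
    thus ?thesis using JL(3) unfolding sums_def J[abs_def] by (simp only:)
  qed
  have "hyp_continuation a b c (\<lambda>w. rGamma c / m 0 * I w)"
    unfolding hyp_continuation_iff
  proof (intro conjI ballI)
    show "(\<lambda>w. rGamma c / m 0 * I w) holomorphic_on cut_plane"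
      by (intro holomorphic_on_mult holomorphic_on_const hol)
  next
    fix w :: complex assume "w \<in> ball 0 1"
    hence "(\<lambda>k. rGamma c / m 0 * (pochhammer a k / fact k * w ^ k * m k)) sums (rGamma c / m 0 * I w)"
      by (intro sums_mult sums) auto
    also have "(\<lambda>k. rGamma c / m 0 * (pochhammer a k / fact k * w ^ k * m k)) =
        (\<lambda>k. pochhammer a k * pochhammer b k * rGamma (c + of_nat k) / fact k * w ^ k)"
    proof
      fix k
      have "rGamma c * m k = (m k * pochhammer c k) * rGamma (c + of_nat k)"
        by (subst pochhammer_rGamma[of c k]) (simp only: mult_ac)
      also have "\<dots> = m 0 * (pochhammer b k * rGamma (c + of_nat k))"
        unfolding mk by (rule mult.assoc)
      finally have *: "rGamma c * m k = m 0 * (pochhammer b k * rGamma (c + of_nat k))" .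
      have "rGamma c / m 0 * (pochhammer a k / fact k * w ^ k * m k) =
              (rGamma c * m k) / m 0 * (pochhammer a k / fact k * w ^ k)"
        by (simp only: divide_inverse mult_ac)
      also have "\<dots> = pochhammer b k * rGamma (c + of_nat k) * (pochhammer a k / fact k * w ^ k)"
        unfolding * nonzero_mult_div_cancel_left[OF m0] ..
      finally show "rGamma c / m 0 * (pochhammer a k / fact k * w ^ k * m k) =
        pochhammer a k * pochhammer b k * rGamma (c + of_nat k) / fact k * w ^ k"
        by (simp only: divide_inverse mult_ac)
    qed
    finally show "(\<lambda>k. pochhammer a k * pochhammer b k * rGamma (c + of_nat k) / fact k * w ^ k) sums
        (rGamma c / m 0 * I w)" .
  qed
  thus ?thesis by blast
qed

section \<open>Contiguous relations and existence of the continuation\<close>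

lemma hyp_fps_nth: "fps_nth (hyp_fps a b c) k = pochhammer a k * pochhammer b k * rGamma (c + of_nat k) / fact k"
  by (simp add: hyp_fps_def)

text \<open>
  The operator \<open>w d/dw + c\<close> multiplies the \<open>n\<close>-th coefficient by \<open>c + n\<close>, which lowers the argument of
  the reciprocal Gamma function by one.
\<close>

lemma hyp_fps_lower_c:
  "hyp_fps a b c = fps_X * fps_deriv (hyp_fps a b (c + 1)) + fps_const c * hyp_fps a b (c + 1)"
proof (rule fps_ext)
  fix n :: nat
  have r: "rGamma (c + of_nat n) = (c + of_nat n) * rGamma (c + 1 + of_nat n)"
    using rGamma_plus1[of "c + of_nat n"] by (simp add: add_ac)
  have "fps_nth (fps_X * fps_deriv (hyp_fps a b (c + 1))) n = of_nat n * fps_nth (hyp_fps a b (c + 1)) n"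
    by (cases n) (simp_all add: add_ac)
  thus "fps_nth (hyp_fps a b c) n =
      fps_nth (fps_X * fps_deriv (hyp_fps a b (c + 1)) + fps_const c * hyp_fps a b (c + 1)) n"
    by (simp add: hyp_fps_nth r add_divide_distrib [symmetric] algebra_simps)
qed

text \<open>
  A contiguous relation that expresses the function with parameter \<open>b\<close> by the one with parameter \<open>b + 1\<close>; together
  with the previous relation it carries the continuation from the domain of Euler's integral to all parameters.
  In this proof and the next two, the coefficients of index \<open>k\<close> and \<open>k + 1\<close> are written as polynomial multiples of
  a common quantity \<open>P\<close>, after which the relation is a polynomial identity.
\<close>

lemma hyp_fps_lower_b:
  fixes a b c :: complex
  defines "F \<equiv> hyp_fps a (b + 1) c"
  shows "fps_const (c - b - 1) * hyp_fps a b c =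
     fps_X * fps_deriv F - fps_X * (fps_X * fps_deriv F) + fps_const (c - b - 1) * F - fps_const a * (fps_X * F)"
proof (rule fps_ext)
  fix n :: nat
  have D: "fps_nth (fps_X * fps_deriv F) n = of_nat n * fps_nth F n" for n
    by (cases n) (simp_all add: add_ac)
  show "fps_nth (fps_const (c - b - 1) * hyp_fps a b c) n = fps_nth (fps_X * fps_deriv F -
      fps_X * (fps_X * fps_deriv F) + fps_const (c - b - 1) * F - fps_const a * (fps_X * F)) n"
  proof (cases n)
    case 0
    thus ?thesis by (simp add: F_def hyp_fps_nth)
  next
    case (Suc k)
    define P where "P = pochhammer a k * pochhammer (b + 1) k * rGamma (c + of_nat (Suc k)) / fact (Suc k)"
    have r: "rGamma (c + of_nat k) = (c + of_nat k) * rGamma (c + of_nat (Suc k))"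
      using rGamma_plus1[of "c + of_nat k"] by (simp add: add_ac)
    have f: "1 / fact k = of_nat (Suc k) / (fact (Suc k) :: complex)"
      by (simp del: of_nat_Suc)
    have 1: "fps_nth F k = of_nat (Suc k) * (c + of_nat k) * P"
      unfolding F_def hyp_fps_nth r P_def using f by (simp add: field_simps del: of_nat_Suc fact_Suc)
    have 2: "fps_nth F (Suc k) = (a + of_nat k) * (b + 1 + of_nat k) * P"
      unfolding F_def hyp_fps_nth P_def pochhammer_Suc by (simp add: mult_ac del: of_nat_Suc fact_Suc)
    have 3: "fps_nth (hyp_fps a b c) (Suc k) = (a + of_nat k) * b * P"
      unfolding hyp_fps_nth P_def pochhammer_rec[of b] pochhammer_Suc[of a] by (simp add: mult_ac del: of_nat_Suc fact_Suc)
    have 4: "fps_nth (fps_X * (fps_X * fps_deriv F)) (Suc k) = of_nat k * fps_nth F k"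
            "fps_nth (fps_X * F) (Suc k) = fps_nth F k"
      unfolding fps_X_mult_nth[of "fps_X * fps_deriv F"] fps_X_mult_nth[of F] D by simp_all
    show ?thesis unfolding Suc fps_add_nth fps_sub_nth fps_mult_left_const_nth D 4 1 2 3
      by (simp add: algebra_simps)
  qed
qed

text \<open>
  Gauss's hypergeometric equation, in terms of coefficients.
\<close>

lemma hyp_fps_ode:
  fixes a b c :: complex
  defines "F \<equiv> hyp_fps a b c"
  shows "fps_X * fps_deriv (fps_deriv F) - fps_X * (fps_X * fps_deriv (fps_deriv F)) +
     fps_const c * fps_deriv F - fps_const (a + b + 1) * (fps_X * fps_deriv F) - fps_const (a * b) * F = 0"
proof (rule fps_ext)
  fix n :: nat
  have D: "fps_nth (fps_X * fps_deriv F) n = of_nat n * fps_nth F n" for n and F :: "complex fps"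
    by (cases n) (simp_all add: add_ac)
  have D2: "fps_nth (fps_X * (fps_X * fps_deriv (fps_deriv F))) n = of_nat n * (of_nat n - 1) * fps_nth F n" for n and F :: "complex fps"
  proof (cases n)
    case (Suc k)
    thus ?thesis by (cases k) (simp_all add: algebra_simps)
  qed auto
  define P where "P = pochhammer a n * pochhammer b n * rGamma (c + of_nat (Suc n)) / fact (Suc n)"
  have r: "rGamma (c + of_nat n) = (c + of_nat n) * rGamma (c + of_nat (Suc n))"
    using rGamma_plus1[of "c + of_nat n"] by (simp add: add_ac)
  have f: "1 / fact n = of_nat (Suc n) / (fact (Suc n) :: complex)"
    by (simp del: of_nat_Suc)
  have 1: "fps_nth F n = of_nat (Suc n) * (c + of_nat n) * P"
    unfolding F_def hyp_fps_nth r P_def using f by (simp add: field_simps del: of_nat_Suc fact_Suc)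
  have 2: "fps_nth F (Suc n) = (a + of_nat n) * (b + of_nat n) * P"
    unfolding F_def hyp_fps_nth P_def pochhammer_Suc by (simp add: mult_ac del: of_nat_Suc fact_Suc)
  show "fps_nth (fps_X * fps_deriv (fps_deriv F) - fps_X * (fps_X * fps_deriv (fps_deriv F)) +
     fps_const c * fps_deriv F - fps_const (a + b + 1) * (fps_X * fps_deriv F) - fps_const (a * b) * F) n = fps_nth 0 n"
    unfolding fps_sub_nth fps_add_nth D2 fps_mult_left_const_nth unfolding D
    by (simp add: 1 2) (simp add: algebra_simps)
qed

text \<open>
  Gauss's relation between \<open>c - 1\<close>, \<open>c\<close> and \<open>c + 1\<close>. Its middle coefficient vanishes at \<open>w = 1/2\<close> when \<open>a + b = 1\<close>, which
  is what makes the value there computable.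
\<close>

lemma hyp_fps_three_term:
  fixes a b c :: complex
  shows "fps_X * hyp_fps a b (c - 1) - hyp_fps a b (c - 1) + fps_const (c - 1) * hyp_fps a b c
     - fps_const (2 * c - a - b - 1) * (fps_X * hyp_fps a b c)
     + fps_const ((c - a) * (c - b)) * (fps_X * hyp_fps a b (c + 1)) = 0" (is "?L = 0")
proof (rule fps_ext)
  fix n :: nat
  show "fps_nth ?L n = fps_nth 0 n"
  proof (cases n)
    case 0
    thus ?thesis using rGamma_plus1[of "c - 1"] by (simp add: hyp_fps_nth)
  next
    case (Suc k)
    define G where "G = rGamma (c + of_nat (Suc k))"
    define P where "P = pochhammer a k * pochhammer b k * G / fact (Suc k)"
    have r1: "rGamma (c + of_nat k) = (c + of_nat k) * G"
      unfolding G_def using rGamma_plus1[of "c + of_nat k"] by (simp add: add_ac)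
    have r2: "rGamma (c - 1 + of_nat k) = (c - 1 + of_nat k) * ((c + of_nat k) * G)"
      unfolding r1[symmetric] using rGamma_plus1[of "c - 1 + of_nat k"] by (simp add: add_ac)
    have r3: "rGamma (c + 1 + of_nat k) = G" "rGamma (c - 1 + of_nat (Suc k)) = (c + of_nat k) * G"
      by (simp add: G_def add_ac, simp flip: r1)
    have f: "1 / fact k = of_nat (Suc k) / (fact (Suc k) :: complex)"
      by (simp del: of_nat_Suc)
    have 1: "fps_nth (hyp_fps a b (c - 1)) k = of_nat (Suc k) * (c - 1 + of_nat k) * (c + of_nat k) * P"
      unfolding hyp_fps_nth r2 P_def using f by (simp add: field_simps del: of_nat_Suc fact_Suc)
    have 2: "fps_nth (hyp_fps a b (c - 1)) (Suc k) = (a + of_nat k) * (b + of_nat k) * (c + of_nat k) * P"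
      unfolding hyp_fps_nth r3 P_def pochhammer_Suc by (simp add: mult_ac del: of_nat_Suc fact_Suc)
    have 3: "fps_nth (hyp_fps a b c) k = of_nat (Suc k) * (c + of_nat k) * P"
      unfolding hyp_fps_nth r1 P_def using f by (simp add: field_simps del: of_nat_Suc fact_Suc)
    have 4: "fps_nth (hyp_fps a b c) (Suc k) = (a + of_nat k) * (b + of_nat k) * P"
      unfolding hyp_fps_nth P_def G_def pochhammer_Suc by (simp add: mult_ac del: of_nat_Suc fact_Suc)
    have 5: "fps_nth (hyp_fps a b (c + 1)) k = of_nat (Suc k) * P"
      unfolding hyp_fps_nth r3 P_def using f by (simp add: field_simps del: of_nat_Suc fact_Suc)
    show ?thesis unfolding Suc
      by (simp add: 1 2 3 4 5) (simp add: algebra_simps)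
  qed
qed

lemma hyp_continuation_lower_c:
  assumes "hyp_continuation a b (c + 1) f"
  shows "hyp_continuation a b c (\<lambda>w. w * deriv f w + c * f w)"
proof -
  have f: "f holomorphic_on cut_plane" "f has_fps_expansion hyp_fps a b (c + 1)"
    using assms by (simp_all add: hyp_continuation_def)
  show ?thesis
    unfolding hyp_continuation_def
  proof
    show "(\<lambda>w. w * deriv f w + c * f w) holomorphic_on cut_plane"
      by (intro holomorphic_intros f holomorphic_deriv open_cut_plane)
    show "(\<lambda>w. w * deriv f w + c * f w) has_fps_expansion hyp_fps a b c"
      unfolding hyp_fps_lower_c[of a b c] by (intro fps_expansion_intros f)
  qed
qed

lemma hyp_continuation_lower_b:
  assumes "hyp_continuation a (b + 1) c f" "c - b - 1 \<noteq> 0"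
  shows "hyp_continuation a b c
           (\<lambda>w. inverse (c - b - 1) * (w * deriv f w - w * (w * deriv f w) + (c - b - 1) * f w - a * (w * f w)))"
    (is "hyp_continuation _ _ _ ?g")
proof -
  have f: "f holomorphic_on cut_plane" "f has_fps_expansion hyp_fps a (b + 1) c"
    using assms by (simp_all add: hyp_continuation_def)
  have "hyp_fps a b c = fps_const (inverse (c - b - 1)) * (fps_const (c - b - 1) * hyp_fps a b c)"
    using assms(2) by (subst mult.assoc[symmetric]) (simp del: fps_const_sub)
  note eq = this[unfolded hyp_fps_lower_b]
  show ?thesis
    unfolding hyp_continuation_def
  proof
    show "?g holomorphic_on cut_plane"
      by (intro holomorphic_intros f holomorphic_deriv open_cut_plane)
    show "?g has_fps_expansion hyp_fps a b c"
      unfolding eq by (intro fps_expansion_intros f)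
  qed
qed

text \<open>
  Shifting \<open>b\<close> up until \<open>Re b > 1\<close>, and then \<open>c\<close> up until it is far to the right of \<open>b\<close>, leads to parameters for which
  Euler's integral gives the continuation. The two contiguous relations lead back. The order matters: lowering \<open>b\<close> divides by
  \<open>c - b - 1\<close>, which is nonzero as long as the real part of \<open>c\<close> is large, so \<open>b\<close> is lowered first.
\<close>

lemma ex_hyp_continuation: "\<exists>f. hyp_continuation a b c f"
proof -
  have low_b: "\<exists>f. hyp_continuation a b c f" if "Re (c - b) > of_nat n + 1" "Re b + of_nat n > 1" for n b c
    using that
  proof (induction n arbitrary: b)
    case 0
    thus ?case by (intro euler_integral_continuation) auto
  next
    case (Suc n)
    have "\<exists>f. hyp_continuation a (b + 1) c f"
      using Suc.prems by (intro Suc.IH) auto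
    then obtain f where "hyp_continuation a (b + 1) c f" by blast
    moreover have "c - b - 1 \<noteq> 0"
    proof
      assume "c - b - 1 = 0"
      hence "Re (c - b - 1) = 0" by (simp only: zero_complex.sel)
      thus False using Suc.prems by simp
    qed
    ultimately show ?case using hyp_continuation_lower_b by blast
  qed
  have low_c: "\<exists>f. hyp_continuation a b c f" if "Re c + of_nat m - Re b > of_nat n + 1" "Re b + of_nat n > 1" for m n c
    using that
  proof (induction m arbitrary: c)
    case 0
    thus ?case by (intro low_b) auto
  next
    case (Suc m)
    have "\<exists>f. hyp_continuation a b (c + 1) f"
      using Suc.prems by (intro Suc.IH) auto
    then obtain f where "hyp_continuation a b (c + 1) f" by blast
    thus ?case using hyp_continuation_lower_c by blast
  qed
  obtain n :: nat where n: "real n > 1 - Re b" using reals_Archimedean2 by blast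
  obtain m :: nat where m: "real m > real n + 1 + Re b - Re c" using reals_Archimedean2 by blast
  show ?thesis by (rule low_c[where n = n and m = m]) (use m n in simp_all)
qed

lemma hyp2F1_reg_continuation: "hyp_continuation a b c (hyp2F1_reg a b c)"
proof -
  have "hyp2F1_reg a b c = (SOME f. hyp_continuation a b c f)"
    unfolding hyp_continuation_iff cut_plane_def hyp2F1_reg_def ..
  thus ?thesis
    using someI_ex[OF ex_hyp_continuation] by simp
qed

lemma holomorphic_hyp2F1_reg: "hyp2F1_reg a b c holomorphic_on cut_plane"
  and hyp2F1_reg_expansion: "hyp2F1_reg a b c has_fps_expansion hyp_fps a b c"
  using hyp2F1_reg_continuation[of a b c] by (simp_all add: hyp_continuation_def)

lemma hyp2F1_reg_lower_c:
  assumes "w \<in> cut_plane"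
  shows "w * deriv (hyp2F1_reg a b (c + 1)) w + c * hyp2F1_reg a b (c + 1) w = hyp2F1_reg a b c w"
  using hyp_continuation_lower_c[OF hyp2F1_reg_continuation, of a b c]
  by (intro eq_on_cut_plane[OF _ holomorphic_hyp2F1_reg _ hyp2F1_reg_expansion assms])
     (simp_all add: hyp_continuation_def)

lemma hyp2F1_reg_ode:
  fixes a b c w :: complex
  assumes "w \<in> cut_plane"
  defines "F \<equiv> hyp2F1_reg a b c"
  shows "w * (1 - w) * deriv (deriv F) w + (c - (a + b + 1) * w) * deriv F w - a * b * F w = 0"
proof -
  have F: "F holomorphic_on cut_plane" "F has_fps_expansion hyp_fps a b c"
    unfolding F_def by (rule holomorphic_hyp2F1_reg hyp2F1_reg_expansion)+
  have "w * deriv (deriv F) w - w * (w * deriv (deriv F) w) + c * deriv F w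
          - (a + b + 1) * (w * deriv F w) - a * b * F w = 0"
  proof (rule eq_on_cut_plane[where F = 0 and g = "\<lambda>_. 0" and
      f = "\<lambda>w. w * deriv (deriv F) w - w * (w * deriv (deriv F) w) + c * deriv F w
          - (a + b + 1) * (w * deriv F w) - a * b * F w"])
    show "(\<lambda>w. w * deriv (deriv F) w - w * (w * deriv (deriv F) w) + c * deriv F w
          - (a + b + 1) * (w * deriv F w) - a * b * F w) holomorphic_on cut_plane"
      by (intro holomorphic_intros F holomorphic_deriv open_cut_plane)
    show "(\<lambda>w. w * deriv (deriv F) w - w * (w * deriv (deriv F) w) + c * deriv F w
          - (a + b + 1) * (w * deriv F w) - a * b * F w) has_fps_expansion 0"
      unfolding hyp_fps_ode[of a b c, symmetric] by (intro fps_expansion_intros F)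
  qed (use assms in simp_all)
  thus ?thesis by (simp add: algebra_simps)
qed

lemma hyp2F1_reg_three_term:
  assumes "w \<in> cut_plane"
  shows "(w - 1) * hyp2F1_reg a b (c - 1) w + (c - 1 - (2 * c - a - b - 1) * w) * hyp2F1_reg a b c w
           + (c - a) * (c - b) * w * hyp2F1_reg a b (c + 1) w = 0"
proof -
  have "w * hyp2F1_reg a b (c - 1) w - hyp2F1_reg a b (c - 1) w + (c - 1) * hyp2F1_reg a b c w
      - (2 * c - a - b - 1) * (w * hyp2F1_reg a b c w) + (c - a) * (c - b) * (w * hyp2F1_reg a b (c + 1) w) = 0"
  proof (rule eq_on_cut_plane[where F = 0 and g = "\<lambda>_. 0" and
      f = "\<lambda>w. w * hyp2F1_reg a b (c - 1) w - hyp2F1_reg a b (c - 1) w + (c - 1) * hyp2F1_reg a b c w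
      - (2 * c - a - b - 1) * (w * hyp2F1_reg a b c w) + (c - a) * (c - b) * (w * hyp2F1_reg a b (c + 1) w)"])
    show "(\<lambda>w. w * hyp2F1_reg a b (c - 1) w - hyp2F1_reg a b (c - 1) w + (c - 1) * hyp2F1_reg a b c w
      - (2 * c - a - b - 1) * (w * hyp2F1_reg a b c w) + (c - a) * (c - b) * (w * hyp2F1_reg a b (c + 1) w))
        holomorphic_on cut_plane"
      by (intro holomorphic_intros holomorphic_hyp2F1_reg)
    show "(\<lambda>w. w * hyp2F1_reg a b (c - 1) w - hyp2F1_reg a b (c - 1) w + (c - 1) * hyp2F1_reg a b c w
      - (2 * c - a - b - 1) * (w * hyp2F1_reg a b c w) + (c - a) * (c - b) * (w * hyp2F1_reg a b (c + 1) w))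
        has_fps_expansion 0"
      unfolding hyp_fps_three_term[of a b c, symmetric] by (intro fps_expansion_intros hyp2F1_reg_expansion)
  qed (use assms in simp_all)
  thus ?thesis by (simp add: algebra_simps)
qed

section \<open>Pfaff's transformation\<close>

text \<open>
  The binomial series of \<open>(1 - z) powr (- s)\<close>; see \<open>neg_power_expansion\<close>.
\<close>

definition neg_power_fps :: "complex \<Rightarrow> complex fps" where
  "neg_power_fps s = Abs_fps (\<lambda>k. pochhammer s k / fact k)"

lemma neg_power_expansion: "(\<lambda>z. (1 - z) powr (- s)) has_fps_expansion neg_power_fps s"
proof (rule has_fps_expansionI)
  have "eventually (\<lambda>z::complex. z \<in> ball 0 1) (nhds 0)"
    by (rule eventually_nhds_in_open) auto
  thus "eventually (\<lambda>z. (\<lambda>n. fps_nth (neg_power_fps s) n * z ^ n) sums (1 - z) powr (- s)) (nhds 0)"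
  proof eventually_elim
    case (elim z)
    hence "norm z < 1" by simp
    from binomial_series_pochhammer[OF this, of s]
    show ?case by (simp add: neg_power_fps_def)
  qed
qed

lemma neg_power_fps_add: "neg_power_fps s * neg_power_fps t = neg_power_fps (s + t)"
proof (rule fps_ext)
  fix n :: nat
  have "fps_nth (neg_power_fps s * neg_power_fps t) n =
          (\<Sum>k\<le>n. of_nat (n choose k) * pochhammer s k * pochhammer t (n - k)) / fact n"
    unfolding fps_mult_nth sum_divide_distrib atLeast0AtMost
    by (intro sum.cong refl) (simp add: neg_power_fps_def binomial_fact field_simps)
  thus "fps_nth (neg_power_fps s * neg_power_fps t) n = fps_nth (neg_power_fps (s + t)) n"
    by (simp add: neg_power_fps_def pochhammer_binomial_sum)
qed

lemma neg_power_fps_power: "neg_power_fps 1 ^ n = neg_power_fps (of_nat n)"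
proof (induction n)
  case 0
  show ?case by (rule fps_ext) (simp add: neg_power_fps_def pochhammer_0_left)
qed (simp_all add: neg_power_fps_add)

text \<open>
  Only the first \<open>n\<close> powers of \<open>Y\<close> contribute to the \<open>n\<close>-th coefficient, so the infinite sum defining the
  composition can be interchanged with the multiplication by \<open>A\<close>.
\<close>

lemma fps_mult_compose_nth:
  fixes A G Y :: "'a :: comm_ring_1 fps"
  assumes "fps_nth Y 0 = 0"
  shows "fps_nth (A * (G oo Y)) n = (\<Sum>i\<le>n. fps_nth G i * fps_nth (A * Y ^ i) n)"
proof -
  have comp: "fps_nth (G oo Y) m = (\<Sum>i\<le>n. fps_nth G i * fps_nth (Y ^ i) m)" if "m \<le> n" for m
  proof -
    have "fps_nth (G oo Y) m = (\<Sum>i=0..m. fps_nth G i * fps_nth (Y ^ i) m)"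
      by (rule fps_compose_nth)
    also have "\<dots> = (\<Sum>i\<le>n. fps_nth G i * fps_nth (Y ^ i) m)"
      by (rule sum.mono_neutral_left)
         (use that startsby_zero_power_prefix[OF assms] in auto)
    finally show ?thesis .
  qed
  have "fps_nth (A * (G oo Y)) n = (\<Sum>j=0..n. fps_nth A j * (\<Sum>i\<le>n. fps_nth G i * fps_nth (Y ^ i) (n - j)))"
    unfolding fps_mult_nth by (intro sum.cong refl) (simp add: comp)
  also have "\<dots> = (\<Sum>j=0..n. \<Sum>i\<le>n. fps_nth G i * (fps_nth A j * fps_nth (Y ^ i) (n - j)))"
    by (simp only: sum_distrib_left mult_ac)
  also have "\<dots> = (\<Sum>i\<le>n. \<Sum>j=0..n. fps_nth G i * (fps_nth A j * fps_nth (Y ^ i) (n - j)))"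
    by (rule sum.swap)
  also have "\<dots> = (\<Sum>i\<le>n. fps_nth G i * fps_nth (A * Y ^ i) n)"
    by (simp only: sum_distrib_left fps_mult_nth)
  finally show ?thesis .
qed

lemma pochhammer_reflect:
  fixes x :: "'a :: comm_ring_1"
  shows "pochhammer x m = (- 1) ^ m * pochhammer (1 - x - of_nat m) m"
proof -
  have "1 - x - of_nat m = - x - of_nat m + 1" by simp
  thus ?thesis using pochhammer_minus[of "- x" m] by (simp only: minus_minus)
qed

text \<open>
  Reflecting the second Pochhammer symbol turns the alternating sum into the binomial theorem for rising
  factorials.
\<close>

lemma chu_vandermonde:
  fixes c d :: "'a :: comm_ring_1"
  shows "(\<Sum>i\<le>n. of_nat (n choose i) * (- 1) ^ i * pochhammer d i * pochhammer (c + of_nat i) (n - i))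
          = pochhammer (c - d) n"
proof -
  have "(\<Sum>i\<le>n. of_nat (n choose i) * (- 1) ^ i * pochhammer d i * pochhammer (c + of_nat i) (n - i))
      = (\<Sum>i\<le>n. (- 1) ^ n * (of_nat (n choose i) * pochhammer d i * pochhammer (1 - c - of_nat n) (n - i)))"
  proof (intro sum.cong refl)
    fix i assume i: "i \<in> {..n}"
    have "1 - (c + of_nat i) - of_nat (n - i) = 1 - c - of_nat n"
      using i by (simp add: of_nat_diff)
    hence 1: "pochhammer (c + of_nat i) (n - i) = (- 1) ^ (n - i) * pochhammer (1 - c - of_nat n) (n - i)"
      by (subst pochhammer_reflect) (simp only:)
    have 2: "(- 1) ^ n = (- 1) ^ i * (- 1 :: 'a) ^ (n - i)"
      using i by (simp flip: power_add)
    show "of_nat (n choose i) * (- 1) ^ i * pochhammer d i * pochhammer (c + of_nat i) (n - i)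
        = (- 1) ^ n * (of_nat (n choose i) * pochhammer d i * pochhammer (1 - c - of_nat n) (n - i))"
      unfolding 1 2 by (simp only: mult_ac)
  qed
  also have "\<dots> = (- 1) ^ n * pochhammer (d + (1 - c - of_nat n)) n"
    unfolding pochhammer_binomial_sum sum_distrib_left ..
  also have "\<dots> = pochhammer (c - d) n"
  proof -
    have "d + (1 - c - of_nat n) = 1 - (c - d) - of_nat n" by simp
    thus ?thesis unfolding pochhammer_reflect[of "c - d" n] by (simp only:)
  qed
  finally show ?thesis .
qed

text \<open>
  Pfaff's transformation, coefficientwise. The substitution \<open>w / (w - 1)\<close> has the series \<open>- X (1 - X)\<^sup>-\<^sup>1\<close>, and
  its \<open>i\<close>-th power combines with \<open>(1 - X)\<^sup>-\<^sup>a\<close> to a single binomial series, so that each coefficient of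
  the product is a finite sum of the Chu-Vandermonde type.
\<close>

lemma pfaff_fps:
  "neg_power_fps a * (hyp_fps a (c - b) c oo (- (fps_X * neg_power_fps 1))) = hyp_fps a b c"
proof (rule fps_ext)
  fix n :: nat
  let ?Y = "- (fps_X * neg_power_fps 1)"
  have "fps_nth (neg_power_fps a * (hyp_fps a (c - b) c oo ?Y)) n =
          (\<Sum>i\<le>n. fps_nth (hyp_fps a (c - b) c) i * fps_nth (neg_power_fps a * ?Y ^ i) n)"
    by (rule fps_mult_compose_nth) simp
  also have "\<dots> = (\<Sum>i\<le>n. pochhammer a n * rGamma (c + of_nat n) / fact n *
      (of_nat (n choose i) * (- 1) ^ i * pochhammer (c - b) i * pochhammer (c + of_nat i) (n - i)))"
  proof (intro sum.cong refl)
    fix i assume "i \<in> {..n}"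
    hence i: "i \<le> n" by simp
    have "neg_power_fps a * ?Y ^ i = fps_const ((- 1) ^ i) * (fps_X ^ i * neg_power_fps (a + of_nat i))"
      unfolding power_minus[of "fps_X * neg_power_fps 1"] power_mult_distrib neg_power_fps_power
        neg_power_fps_add[symmetric] by (simp flip: fps_const_power add: mult_ac fps_const_neg[symmetric] del: fps_const_neg)
    hence 1: "fps_nth (neg_power_fps a * ?Y ^ i) n = (- 1) ^ i * (pochhammer (a + of_nat i) (n - i) / fact (n - i))"
      using i by (simp add: fps_X_power_mult_nth neg_power_fps_def)
    have 2: "pochhammer a n = pochhammer a i * pochhammer (a + of_nat i) (n - i)"
      using i by (rule pochhammer_product)
    have 3: "rGamma (c + of_nat i) = pochhammer (c + of_nat i) (n - i) * rGamma (c + of_nat n)"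
      using pochhammer_rGamma[of "c + of_nat i" "n - i"] i by (simp add: of_nat_diff)
    have 4: "of_nat (n choose i) = (fact n / (fact i * fact (n - i)) :: complex)"
      using i by (rule binomial_fact)
    show "fps_nth (hyp_fps a (c - b) c) i * fps_nth (neg_power_fps a * ?Y ^ i) n =
        pochhammer a n * rGamma (c + of_nat n) / fact n *
        (of_nat (n choose i) * (- 1) ^ i * pochhammer (c - b) i * pochhammer (c + of_nat i) (n - i))"
      unfolding 1 2 3 4 hyp_fps_nth by simp
  qed
  also have "\<dots> = pochhammer a n * rGamma (c + of_nat n) / fact n * pochhammer (c - (c - b)) n"
    unfolding chu_vandermonde[symmetric] sum_distrib_left ..
  finally show "fps_nth (neg_power_fps a * (hyp_fps a (c - b) c oo ?Y)) n = fps_nth (hyp_fps a b c) n"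
    by (simp add: hyp_fps_nth)
qed

lemma pfaff_arg_in_cut_plane:
  assumes "w \<in> cut_plane"
  shows "w / (w - 1) \<in> cut_plane" "w \<noteq> 1"
proof -
  show 1: "w \<noteq> 1" using assms by (auto simp: cut_plane_iff')
  have "1 - (1 - d) / ((1 - d) - 1) = inverse d" if "d \<noteq> 0" for d :: complex
    using that by (simp add: field_simps)
  from this[of "1 - w"] have "1 - w / (w - 1) = inverse (1 - w)"
    using 1 by simp
  thus "w / (w - 1) \<in> cut_plane"
    using assms by (simp add: cut_plane_iff)
qed

lemma hyp2F1_reg_pfaff:
  assumes "w \<in> cut_plane"
  shows "hyp2F1_reg a b c w = (1 - w) powr (- a) * hyp2F1_reg a (c - b) c (w / (w - 1))"
proof (rule eq_on_cut_plane[OF holomorphic_hyp2F1_reg _ hyp2F1_reg_expansion _ assms])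
  have "(hyp2F1_reg a (c - b) c \<circ> (\<lambda>w. w / (w - 1))) holomorphic_on cut_plane"
    by (rule holomorphic_on_compose_gen[OF _ holomorphic_hyp2F1_reg])
       (use pfaff_arg_in_cut_plane in \<open>force intro!: holomorphic_intros\<close>)+
  thus "(\<lambda>w. (1 - w) powr (- a) * hyp2F1_reg a (c - b) c (w / (w - 1))) holomorphic_on cut_plane"
    unfolding o_def by (intro holomorphic_intros) (simp_all add: cut_plane_iff)
  have "(\<lambda>w. - (w * (1 - w) powr (- 1))) has_fps_expansion - (fps_X * neg_power_fps 1)"
    by (intro fps_expansion_intros neg_power_expansion)
  moreover have "- (w * (1 - w) powr (- 1)) = w / (w - 1)" for w :: complex
    by (cases "w = 1") (simp_all add: powr_minus field_simps)
  ultimately have Y: "(\<lambda>w::complex. w / (w - 1)) has_fps_expansion - (fps_X * neg_power_fps 1)"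
    by simp
  have "(hyp2F1_reg a (c - b) c \<circ> (\<lambda>w. w / (w - 1))) has_fps_expansion
      (hyp_fps a (c - b) c oo (- (fps_X * neg_power_fps 1)))"
    by (rule has_fps_expansion_compose[OF hyp2F1_reg_expansion Y]) simp
  thus "(\<lambda>w. (1 - w) powr (- a) * hyp2F1_reg a (c - b) c (w / (w - 1))) has_fps_expansion hyp_fps a b c"
    unfolding pfaff_fps[of a c b, symmetric] o_def by (intro fps_expansion_intros neg_power_expansion)
qed

section \<open>The theorems of Bailey and Kummer\<close>

lemma norm_add_of_nat_mono:
  fixes c :: complex
  assumes "Re c \<ge> 0"
  shows "norm c \<le> norm (c + of_nat n)"
  using assms by (simp add: cmod_def power_mono)

text \<open>
  Supplies a summable majorant that is uniform in \<open>n\<close> when \<open>c\<close> is replaced by \<open>c + n\<close>.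
\<close>

lemma norm_pochhammer_add_of_nat_mono:
  fixes c :: complex
  assumes "Re c \<ge> 0"
  shows "norm (pochhammer c k) \<le> norm (pochhammer (c + of_nat n) k)"
proof (induction k)
  case (Suc k)
  have "norm (c + of_nat k) \<le> norm (c + of_nat k + of_nat n)"
    using assms by (intro norm_add_of_nat_mono) simp
  hence "norm (c + of_nat k) \<le> norm (c + of_nat n + of_nat k)"
    by (simp only: add_ac)
  thus ?case
    unfolding pochhammer_Suc norm_mult using Suc.IH by (intro mult_mono) auto
qed auto

lemma Gamma_nonpole_right_half_plane:
  fixes c :: complex
  assumes "Re c > 0"
  shows "c \<notin> \<int>\<^sub>\<le>\<^sub>0"
proof
  assume "c \<in> \<int>\<^sub>\<le>\<^sub>0"
  then obtain n where "c = of_int n" "n \<le> 0" by (auto elim!: nonpos_Ints_cases)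
  thus False using assms by simp
qed

text \<open>
  Every term of the series except the constant one tends to \<open>0\<close> as the third parameter grows, and the terms are
  dominated by those for \<open>n = 0\<close>; so Tannery's theorem applies.
\<close>

lemma hyp2F1_large_c_limit:
  assumes c: "Re c > 0" and w: "norm w < 1"
  shows "(\<lambda>n. Gamma (c + of_nat n) * hyp2F1_reg a b (c + of_nat n) w) \<longlonglongrightarrow> 1"
proof -
  define f where "f = (\<lambda>k n::nat. pochhammer a k * pochhammer b k / (pochhammer (c + of_nat n) k * fact k) * w ^ k)"
  have nz: "pochhammer (c + of_nat n) k \<noteq> 0" for n k
    using c by (intro pochhammer_nonzero_right_half_plane) simp
  have sums: "(\<lambda>k. pochhammer a k * pochhammer b k / (pochhammer (c + of_nat n) k * fact k) * z ^ k)
      sums (Gamma (c + of_nat n) * hyp2F1_reg a b (c + of_nat n) z)" if "norm z < 1" for n z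
  proof -
    have "(\<lambda>k. Gamma (c + of_nat n) * (pochhammer a k * pochhammer b k * rGamma (c + of_nat n + of_nat k) / fact k * z ^ k))
      sums (Gamma (c + of_nat n) * hyp2F1_reg a b (c + of_nat n) z)"
      using that by (intro sums_mult hyp_continuation_sums hyp2F1_reg_continuation) simp
    also have "(\<lambda>k. Gamma (c + of_nat n) * (pochhammer a k * pochhammer b k * rGamma (c + of_nat n + of_nat k) / fact k * z ^ k))
      = (\<lambda>k. pochhammer a k * pochhammer b k / (pochhammer (c + of_nat n) k * fact k) * z ^ k)"
    proof
      fix k
      have "Gamma (c + of_nat n) * rGamma (c + of_nat n) = 1"
        using c by (subst rGamma_inverse_Gamma)
          (simp add: Gamma_eq_zero_iff Gamma_nonpole_right_half_plane)
      hence "Gamma (c + of_nat n) * rGamma (c + of_nat n + of_nat k) = 1 / pochhammer (c + of_nat n) k"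
        using nz[of n k] by (simp add: pochhammer_rGamma[of "c + of_nat n" k] field_simps)
      thus "Gamma (c + of_nat n) * (pochhammer a k * pochhammer b k * rGamma (c + of_nat n + of_nat k) / fact k * z ^ k)
        = pochhammer a k * pochhammer b k / (pochhammer (c + of_nat n) k * fact k) * z ^ k"
        using nz[of n k] by (simp add: field_simps)
    qed
    finally show ?thesis .
  qed
  obtain r where r: "norm w < r" "r < 1" using dense[OF w] by blast
  have r0: "r > 0" by (rule le_less_trans[OF norm_ge_zero r(1)])
  have summable: "summable (\<lambda>k. norm (f k 0))"
    unfolding f_def
  proof (rule powser_insidea)
    have "norm (complex_of_real r) < 1" using r r0 by simp
    from sums_summable[OF sums[OF this, of 0]]
    show "summable (\<lambda>k. pochhammer a k * pochhammer b k / (pochhammer (c + of_nat 0) k * fact k) * of_real r ^ k)" .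
    show "norm w < norm (complex_of_real r)" using r r0 by simp
  qed
  have "(\<lambda>n. \<Sum>k. f k n) \<longlonglongrightarrow> (\<Sum>k. if k = 0 then 1 else 0)"
  proof (rule tannerys_theorem[THEN conjunct2, THEN conjunct2])
    show "summable (\<lambda>k. norm (f k 0))" by (rule summable)
    show "\<forall>\<^sub>F (k, n) in sequentially \<times>\<^sub>F sequentially. norm (f k n) \<le> norm (f k 0)"
    proof (intro always_eventually allI, clarify)
      fix k n :: nat
      have "norm (pochhammer c k) \<le> norm (pochhammer (c + of_nat n) k)"
        using c by (intro norm_pochhammer_add_of_nat_mono) simp
      thus "norm (f k n) \<le> norm (f k 0)"
        using nz[of n k] nz[of 0 k] unfolding f_def norm_mult norm_divide
        by (intro mult_right_mono divide_left_mono mult_pos_pos) auto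
    qed
    fix k
    show "(\<lambda>n. f k n) \<longlonglongrightarrow> (if k = 0 then 1 else 0)"
    proof (cases k)
      case 0
      thus ?thesis by (simp add: f_def)
    next
      case (Suc j)
      \<comment> \<open>The factor \<open>c + n\<close> of the Pochhammer symbol gives the decay; the other factors are bounded below.\<close>
      define C where "C = norm (pochhammer a k * pochhammer b k * w ^ k / (fact k * pochhammer (c + 1) j))"
      have "(\<lambda>n. f k n) \<longlonglongrightarrow> 0"
      proof (rule Lim_null_comparison)
        show "\<forall>\<^sub>F n in sequentially. norm (f k n) \<le> C * inverse (real n)"
          using eventually_gt_at_top[of 0]
        proof eventually_elim
          case (elim n)
          have 1: "norm (pochhammer (c + 1) j) \<le> norm (pochhammer (c + of_nat n + 1) j)"
            using c norm_pochhammer_add_of_nat_mono[of "c + 1" j n] by (simp add: add_ac)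
          have 2: "real n \<le> norm (c + of_nat n)"
            using c complex_Re_le_cmod[of "c + of_nat n"] by simp
          have 3: "norm (pochhammer (c + 1) j) > 0"
            using c pochhammer_nonzero_right_half_plane[of "c + 1" j] by simp
          have "norm (f k n) = norm (pochhammer a k * pochhammer b k * w ^ k / fact k) /
                  (norm (c + of_nat n) * norm (pochhammer (c + of_nat n + 1) j))"
            unfolding f_def Suc pochhammer_rec[of "c + of_nat n"] norm_mult norm_divide
            by (simp add: field_simps del: fact_Suc)
          also have "\<dots> \<le> norm (pochhammer a k * pochhammer b k * w ^ k / fact k) /
                  (real n * norm (pochhammer (c + 1) j))"
            using 1 2 3 elim by (intro divide_left_mono mult_mono mult_pos_pos) auto
          also have "\<dots> = C * inverse (real n)"
            by (simp add: C_def norm_mult norm_divide field_simps del: fact_Suc)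
          finally show ?case .
        qed
        show "(\<lambda>n. C * inverse (real n)) \<longlonglongrightarrow> 0"
          using tendsto_mult_left[OF lim_inverse_n, of C] by simp
      qed
      thus ?thesis using Suc by simp
    qed
  qed simp
  moreover have "(\<Sum>k. f k n) = Gamma (c + of_nat n) * hyp2F1_reg a b (c + of_nat n) w" for n
    using sums_unique[OF sums[OF w, of n]] by (simp add: f_def)
  moreover have "(\<Sum>k. if k = 0 then 1 else 0 :: complex) = 1"
    using sums_unique[OF sums_single[of 0 "\<lambda>_. 1::complex"]] by simp
  ultimately show ?thesis by simp
qed

lemma half_in_cut_plane: "1 / 2 \<in> cut_plane"
  by (simp add: cut_plane_iff')

text \<open>
  For \<open>a + b = 1\<close> and \<open>w = 1/2\<close> the three-term relation loses its middle term and becomes a first-order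
  recurrence of step two in \<open>c\<close>.
\<close>

lemma hyp2F1_reg_half_shift:
  "hyp2F1_reg a (1 - a) c (1/2) = (c + 1 - a) * (c + a) * hyp2F1_reg a (1 - a) (c + 2) (1/2)"
proof -
  have "(1/2 - 1) * hyp2F1_reg a (1 - a) c (1/2) +
        (c + 1 - a) * (c + 1 - (1 - a)) * (1/2) * hyp2F1_reg a (1 - a) (c + 1 + 1) (1/2) = 0"
    using hyp2F1_reg_three_term[OF half_in_cut_plane, of a "1 - a" "c + 1"] by simp
  moreover have "X = P * Y" if "(1/2 - 1) * X + P * (1/2) * Y = 0" for P X Y :: complex
  proof -
    have "X = P * Y - 2 * ((1/2 - 1) * X + P * (1/2) * Y)" by (simp add: algebra_simps)
    thus ?thesis using that by simp
  qed
  ultimately have "hyp2F1_reg a (1 - a) c (1/2) =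
      (c + 1 - a) * (c + 1 - (1 - a)) * hyp2F1_reg a (1 - a) (c + 1 + 1) (1/2)" by blast
  moreover have "c + 1 - (1 - a) = c + a" "c + 1 + 1 = c + 2" by simp_all
  ultimately show ?thesis by (simp only:)
qed

lemma hyp2F1_reg_half_shift_iterated:
  "hyp2F1_reg a (1 - a) c (1/2) =
     4 ^ n * pochhammer ((c + 1 - a) / 2) n * pochhammer ((c + a) / 2) n *
     hyp2F1_reg a (1 - a) (c + of_nat (2 * n)) (1/2)"
proof (induction n)
  case (Suc n)
  define R where "R = hyp2F1_reg a (1 - a) (c + of_nat (2 * Suc n)) (1/2)"
  have 1: "c + of_nat (2 * n) + 2 = c + of_nat (2 * Suc n)" by simp
  have "hyp2F1_reg a (1 - a) (c + of_nat (2 * n)) (1/2) =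
         (c + of_nat (2 * n) + 1 - a) * (c + of_nat (2 * n) + a) * R"
    using hyp2F1_reg_half_shift[of a "c + of_nat (2 * n)"] unfolding 1 R_def .
  also have "\<dots> = 4 * ((c + 1 - a) / 2 + of_nat n) * ((c + a) / 2 + of_nat n) * R"
    by (simp add: field_simps)
  finally show ?case
    unfolding pochhammer_Suc power_Suc R_def[symmetric] by (subst Suc.IH) (simp only: mult_ac)
qed simp

text \<open>
  Iterating the recurrence expresses the value at \<open>c\<close> by a quotient of Pochhammer symbols times a factor that
  tends to \<open>1\<close>. The quotient converges to a quotient of Gamma values by Gauss's product formula, in which the
  exponential factors cancel because \<open>x + y = z + t\<close>.
\<close>

lemma hyp2F1_reg_half_right_half_plane:
  assumes "Re c > 0"
  shows "hyp2F1_reg a (1 - a) c (1/2) =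
     2 powr (1 - c) * of_real (sqrt pi) * rGamma ((c + a) / 2) * rGamma ((c + 1 - a) / 2)"
proof -
  define x y z t where "x = (c + 1 - a) / 2" and "y = (c + a) / 2" and "z = c / 2" and "t = c / 2 + 1 / 2"
  define B where "B = hyp2F1_reg a (1 - a) c (1/2)"
  define L where "L = (\<lambda>n. Gamma (c + of_nat n) * hyp2F1_reg a (1 - a) (c + of_nat n) (1/2))"
  have xyzt: "x + y = z + t" by (simp add: x_def y_def z_def t_def add_divide_distrib[symmetric])
  have pos: "Re z > 0" "Re t > 0" using assms by (simp_all add: z_def t_def)
  have G0: "Gamma c \<noteq> 0" "rGamma z \<noteq> 0" "rGamma t \<noteq> 0"
    using assms pos by (simp_all add: Gamma_eq_zero_iff rGamma_eq_zero_iff Gamma_nonpole_right_half_plane)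
  have "L \<longlonglongrightarrow> 1"
    unfolding L_def using assms by (intro hyp2F1_large_c_limit) auto
  hence L: "(\<lambda>n. L (2 * Suc n)) \<longlonglongrightarrow> 1"
    using LIMSEQ_subseq_LIMSEQ[of L 1 "\<lambda>n. 2 * Suc n"] by (simp add: strict_mono_def o_def)
  have eq: "Gamma c * B = rGamma_series x n * rGamma_series y n / (rGamma_series z n * rGamma_series t n) * L (2 * Suc n)" for n
  proof -
    define E where "E = (\<lambda>s::complex. exp (s * of_real (ln (of_nat n))))"
    have E': "exp (s * of_real (ln (of_nat n))) = E s" for s
      by (simp add: E_def)
    have E: "E x * E y = E z * E t" "E s \<noteq> 0" for s
      using xyzt by (simp_all add: E_def flip: exp_add distrib_right)
    have nz: "pochhammer z (Suc n) \<noteq> 0" "pochhammer t (Suc n) \<noteq> 0"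
      using pos by (simp_all add: pochhammer_nonzero_right_half_plane del: pochhammer_Suc)
    have gam: "Gamma (c + of_nat (2 * Suc n)) = pochhammer c (2 * Suc n) * Gamma c"
      using assms G0(1) by (subst pochhammer_Gamma) (simp_all add: Gamma_nonpole_right_half_plane)
    have p4: "of_nat (2 ^ (2 * Suc n)) = (4 :: complex) ^ Suc n"
      by (simp only: power_mult) simp
    note gam
    also have "pochhammer c (2 * Suc n) = 4 ^ Suc n * pochhammer z (Suc n) * pochhammer t (Suc n)"
      using pochhammer_double[of "c / 2" "Suc n"] unfolding p4 z_def t_def by simp
    finally have "L (2 * Suc n) * (pochhammer x (Suc n) * pochhammer y (Suc n)) =
        Gamma c * pochhammer z (Suc n) * pochhammer t (Suc n) *
        (4 ^ Suc n * pochhammer x (Suc n) * pochhammer y (Suc n) * hyp2F1_reg a (1 - a) (c + of_nat (2 * Suc n)) (1/2))"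
      unfolding L_def by (simp only: mult_ac)
    also have "4 ^ Suc n * pochhammer x (Suc n) * pochhammer y (Suc n) * hyp2F1_reg a (1 - a) (c + of_nat (2 * Suc n)) (1/2) = B"
      unfolding B_def x_def y_def by (rule hyp2F1_reg_half_shift_iterated[symmetric])
    finally have *: "Gamma c * B = pochhammer x (Suc n) * pochhammer y (Suc n) / (pochhammer z (Suc n) * pochhammer t (Suc n)) * L (2 * Suc n)"
      using nz by (simp add: field_simps del: pochhammer_Suc)
    have "rGamma_series x n * rGamma_series y n / (rGamma_series z n * rGamma_series t n) =
       (pochhammer x (Suc n) * pochhammer y (Suc n) / (pochhammer z (Suc n) * pochhammer t (Suc n))) * ((E z * E t) / (E x * E y))"
      unfolding rGamma_series_def Suc_eq_plus1[symmetric] E'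
      by (simp add: divide_simps del: pochhammer_Suc)
    also have "(E z * E t) / (E x * E y) = 1" using E by simp
    finally show ?thesis using * by simp
  qed
  have "(\<lambda>n. rGamma_series x n * rGamma_series y n / (rGamma_series z n * rGamma_series t n) * L (2 * Suc n))
     \<longlonglongrightarrow> rGamma x * rGamma y / (rGamma z * rGamma t) * 1"
    using G0 by (intro tendsto_intros L) auto
  hence "(\<lambda>n::nat. Gamma c * B) \<longlonglongrightarrow> rGamma x * rGamma y / (rGamma z * rGamma t) * 1"
    by (simp only: eq[symmetric])
  hence "Gamma c * B = rGamma x * rGamma y / (rGamma z * rGamma t) * 1"
    by (rule LIMSEQ_unique[OF tendsto_const])
  also have "\<dots> = rGamma x * rGamma y * (Gamma z * Gamma t)"
    by (simp add: rGamma_inverse_Gamma divide_inverse)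
  also have "Gamma z * Gamma t = exp ((1 - c) * of_real (ln 2)) * of_real (sqrt pi) * Gamma c"
    using Gamma_legendre_duplication[of z] pos by (simp add: z_def t_def Gamma_nonpole_right_half_plane)
  also have "exp ((1 - c) * of_real (ln 2)) = 2 powr (1 - c)"
  proof -
    have "Ln 2 = of_real (ln 2)" using Ln_of_real[of 2] by simp
    thus ?thesis by (simp add: powr_def)
  qed
  finally have "Gamma c * B = Gamma c * (2 powr (1 - c) * of_real (sqrt pi) * rGamma y * rGamma x)"
    by (simp only: mult_ac)
  thus ?thesis using G0(1) by (simp add: B_def x_def y_def)
qed

text \<open>
  Bailey's summation theorem. Both sides satisfy the same recurrence in \<open>c\<close>, which removes the restriction on
  the real part of \<open>c\<close>.
\<close>

lemma hyp2F1_reg_half: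
  "hyp2F1_reg a (1 - a) c (1/2) =
     2 powr (1 - c) * of_real (sqrt pi) * rGamma ((c + a) / 2) * rGamma ((c + 1 - a) / 2)"
proof -
  have "hyp2F1_reg a (1 - a) c (1/2) =
     2 powr (1 - c) * of_real (sqrt pi) * rGamma ((c + a) / 2) * rGamma ((c + 1 - a) / 2)"
    if "Re c + of_nat (2 * n) > 0" for n
    using that
  proof (induction n arbitrary: c)
    case 0
    thus ?case by (intro hyp2F1_reg_half_right_half_plane) simp
  next
    case (Suc n)
    have r: "rGamma ((c + a) / 2) = ((c + a) / 2) * rGamma ((c + 2 + a) / 2)"
      "rGamma ((c + 1 - a) / 2) = ((c + 1 - a) / 2) * rGamma ((c + 2 + 1 - a) / 2)"
      using rGamma_plus1[of "(c + a) / 2"] rGamma_plus1[of "(c + 1 - a) / 2"]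
      by (simp_all add: add_divide_distrib diff_divide_distrib algebra_simps)
    have p: "2 powr (1 - c) = 4 * (2::complex) powr (1 - (c + 2))"
    proof -
      have "(2::complex) powr (1 - c) = 2 powr (2 + (1 - (c + 2)))" by simp
      thus ?thesis by (subst (asm) powr_add) simp
    qed
    have "hyp2F1_reg a (1 - a) (c + 2) (1/2) =
       2 powr (1 - (c + 2)) * of_real (sqrt pi) * rGamma ((c + 2 + a) / 2) * rGamma ((c + 2 + 1 - a) / 2)"
      using Suc.prems by (intro Suc.IH) simp
    thus ?case
      unfolding hyp2F1_reg_half_shift[of a c] r p by simp
  qed
  note * = this
  obtain n :: nat where "real n > - Re c" using reals_Archimedean2 by blast
  thus ?thesis by (intro *[of n]) simp
qed

lemma minus_one_in_cut_plane: "-1 \<in> cut_plane"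
  by (simp add: cut_plane_iff')

text \<open>
  Kummer's case \<open>c = 1 + b - a\<close>: Pfaff's transformation sends \<open>-1\<close> to \<open>1/2\<close> and the parameters to those of
  Bailey's theorem.
\<close>

lemma hyp2F1_reg_minus_one:
  assumes "c = 1 + b - a"
  shows "hyp2F1_reg a b c (-1) = 2 powr (- a) * hyp2F1_reg a (1 - a) c (1/2)"
  using hyp2F1_reg_pfaff[OF minus_one_in_cut_plane, of a b c] assms by simp

lemma deriv_hyp2F1_reg:
  assumes "w \<in> cut_plane"
  shows "(hyp2F1_reg a b c has_field_derivative deriv (hyp2F1_reg a b c) w) (at w)"
  by (rule holomorphic_derivI[OF holomorphic_hyp2F1_reg open_cut_plane assms])

text \<open>
  The combination of value and derivative at \<open>-1\<close> that arises from differentiating \<open>exp (\<i> b \<theta>) F (exp (2 \<i> \<theta>))\<close>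
  at \<open>\<theta> = \<pi>/2\<close>. Under Pfaff's transformation it becomes the operator \<open>w d/dw + (c - 1)\<close> at \<open>1/2\<close>, which lowers \<open>c\<close> by
  one, so that Bailey's theorem applies again.
\<close>

lemma deriv_hyp2F1_reg_minus_one:
  assumes "c = 1 + b - a"
  shows "b * hyp2F1_reg a b c (-1) - 2 * deriv (hyp2F1_reg a b c) (-1) =
           2 powr (- a) * hyp2F1_reg a (1 - a) (c - 1) (1/2)"
proof -
  let ?F = "hyp2F1_reg a b c" and ?G = "hyp2F1_reg a (1 - a) c"
  have G: "(?G has_field_derivative deriv ?G (1/2)) (at ((-1) / ((-1) - 1 :: complex)))"
    using deriv_hyp2F1_reg[OF half_in_cut_plane, of a "1 - a" c] by simp
  have g: "((\<lambda>w::complex. w / (w - 1)) has_field_derivative (- 1 / 4)) (at (-1))"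
    by (auto intro!: derivative_eq_intros)
  have p: "((\<lambda>w::complex. (1 - w) powr (- a)) has_field_derivative (a * 2 powr (- a - 1))) (at (-1))"
    by (auto intro!: derivative_eq_intros)
  have "((\<lambda>w. (1 - w) powr (- a) * ?G (w / (w - 1))) has_field_derivative
          (a * 2 powr (- a - 1) * ?G (1/2) + deriv ?G (1/2) * (- 1 / 4) * 2 powr (- a))) (at (-1))"
    using DERIV_mult[OF p DERIV_chain2[OF G g]] by simp
  hence "(?F has_field_derivative
          (a * 2 powr (- a - 1) * ?G (1/2) + deriv ?G (1/2) * (- 1 / 4) * 2 powr (- a))) (at (-1))"
  proof (rule has_field_derivative_transform_within_open[OF _ open_cut_plane minus_one_in_cut_plane])
    fix w assume "w \<in> cut_plane"
    from hyp2F1_reg_pfaff[OF this, of a b c]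
    show "(1 - w) powr (- a) * ?G (w / (w - 1)) = ?F w" using assms by simp
  qed
  hence "deriv ?F (-1) = a * 2 powr (- a - 1) * ?G (1/2) + deriv ?G (1/2) * (- 1 / 4) * 2 powr (- a)"
    by (rule DERIV_imp_deriv)
  moreover have "2 powr (- a - 1) = 2 powr (- a) / (2::complex)"
    by (simp add: powr_diff)
  moreover have "hyp2F1_reg a (1 - a) (c - 1) (1/2) = (1/2) * deriv ?G (1/2) + (c - 1) * ?G (1/2)"
    using hyp2F1_reg_lower_c[OF half_in_cut_plane, of a "1 - a" "c - 1"] by simp
  moreover have "b * (p * g) - 2 * (a * (p / 2) * g + g' * (- 1 / 4) * p) = p * ((1/2) * g' + (c - 1) * g)"
    for p g g' :: complex
  proof -
    have "c - 1 = b - a" using assms by simp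
    thus ?thesis by (simp only:) (simp add: algebra_simps)
  qed
  ultimately show ?thesis
    unfolding hyp2F1_reg_minus_one[OF assms] by (simp only:)
qed

section \<open>Two families of solutions of the Gegenbauer equation\<close>

text \<open>
  Differentiating the equation repeatedly expresses every derivative of \<open>f\<close> as a combination of \<open>f\<close> and \<open>f'\<close> with
  holomorphic coefficients. All derivatives therefore vanish at \<open>z0\<close>, and the identity theorem applies.
\<close>

lemma linear_ode2_zero:
  fixes f f' f'' p q :: "complex \<Rightarrow> complex"
  assumes S: "open S" "connected S" and pq: "p holomorphic_on S" "q holomorphic_on S"
    and f: "\<And>z. z \<in> S \<Longrightarrow> (f has_field_derivative f' z) (at z)"
    and f': "\<And>z. z \<in> S \<Longrightarrow> (f' has_field_derivative f'' z) (at z)"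
    and ode: "\<And>z. z \<in> S \<Longrightarrow> f'' z = p z * f' z + q z * f z"
    and z0: "z0 \<in> S" "f z0 = 0" "f' z0 = 0" and w: "w \<in> S"
  shows "f w = 0"
proof -
  have hol: "f holomorphic_on S" "f' holomorphic_on S"
    using f f' S(1) by (auto simp: holomorphic_on_open)
  have "\<exists>P Q. P holomorphic_on S \<and> Q holomorphic_on S \<and> (\<forall>z\<in>S. (deriv ^^ n) f z = P z * f' z + Q z * f z)" for n
  proof (induction n)
    case 0
    show ?case by (intro exI[of _ "\<lambda>_. 0"] exI[of _ "\<lambda>_. 1"]) auto
  next
    case (Suc n)
    then obtain P Q where PQ: "P holomorphic_on S" "Q holomorphic_on S"
      and eq: "\<And>z. z \<in> S \<Longrightarrow> (deriv ^^ n) f z = P z * f' z + Q z * f z" by blast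
    have "(deriv ^^ Suc n) f z = (deriv P z + P z * p z + Q z) * f' z + (P z * q z + deriv Q z) * f z"
      if z: "z \<in> S" for z
    proof -
      have "eventually (\<lambda>x. x \<in> S) (nhds z)"
        using S(1) z by (rule eventually_nhds_in_open)
      hence "eventually (\<lambda>x. (deriv ^^ n) f x = P x * f' x + Q x * f x) (nhds z)"
        by eventually_elim (rule eq)
      hence "(deriv ^^ Suc n) f z = deriv (\<lambda>x. P x * f' x + Q x * f x) z"
        by (simp add: deriv_cong_ev)
      also have "((\<lambda>x. P x * f' x + Q x * f x) has_field_derivative
          (deriv P z * f' z + f'' z * P z) + (deriv Q z * f z + f' z * Q z)) (at z)"
        by (intro DERIV_add DERIV_mult f f' z holomorphic_derivI[OF _ S(1)] PQ)
      hence "deriv (\<lambda>x. P x * f' x + Q x * f x) z =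
          (deriv P z * f' z + f'' z * P z) + (deriv Q z * f z + f' z * Q z)"
        by (rule DERIV_imp_deriv)
      finally show ?thesis by (simp add: ode[OF z] algebra_simps)
    qed
    moreover have "(\<lambda>z. deriv P z + P z * p z + Q z) holomorphic_on S"
      "(\<lambda>z. P z * q z + deriv Q z) holomorphic_on S"
      by (intro holomorphic_intros PQ pq holomorphic_deriv S)+
    ultimately show ?case by blast
  qed
  hence "(deriv ^^ n) f z0 = 0" for n
    using z0 by (metis add_0 mult_zero_right)
  thus ?thesis
    using holomorphic_fun_eq_0_on_connected[OF hol(1) S _ z0(1) w] by blast
qed

lemma linear_ode2_unique:
  fixes f f' f'' g g' g'' p q :: "complex \<Rightarrow> complex"
  assumes S: "open S" "connected S" and pq: "p holomorphic_on S" "q holomorphic_on S"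
    and f: "\<And>z. z \<in> S \<Longrightarrow> (f has_field_derivative f' z) (at z)"
      "\<And>z. z \<in> S \<Longrightarrow> (f' has_field_derivative f'' z) (at z)"
      "\<And>z. z \<in> S \<Longrightarrow> f'' z = p z * f' z + q z * f z"
    and g: "\<And>z. z \<in> S \<Longrightarrow> (g has_field_derivative g' z) (at z)"
      "\<And>z. z \<in> S \<Longrightarrow> (g' has_field_derivative g'' z) (at z)"
      "\<And>z. z \<in> S \<Longrightarrow> g'' z = p z * g' z + q z * g z"
    and t: "t \<in> S" "f t = g t" "f' t = g' t" and w: "w \<in> S"
  shows "f w = g w"
proof -
  have "(\<lambda>z. f z - g z) w = 0"
  proof (rule linear_ode2_zero[OF S pq, where f = "\<lambda>z. f z - g z" and f' = "\<lambda>z. f' z - g' z"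
        and f'' = "\<lambda>z. f'' z - g'' z"])
    show "((\<lambda>z. f z - g z) has_field_derivative f' z - g' z) (at z)" if "z \<in> S" for z
      by (intro DERIV_diff f g that)
    show "((\<lambda>z. f' z - g' z) has_field_derivative f'' z - g'' z) (at z)" if "z \<in> S" for z
      by (intro DERIV_diff f g that)
    show "f'' z - g'' z = p z * (f' z - g' z) + q z * (f z - g z)" if "z \<in> S" for z
      by (simp add: f(3)[OF that] g(3)[OF that] algebra_simps)
  qed (use t w in auto)
  thus ?thesis by simp
qed

lemma exp_2i_in_cut_plane:
  assumes "sin (Re \<theta>) \<noteq> 0"
  shows "exp (2 * \<i> * \<theta>) \<in> cut_plane"
proof -
  have Re: "Re (exp (2 * \<i> * \<theta>)) = exp (- 2 * Im \<theta>) * cos (2 * Re \<theta>)"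
   and Im: "Im (exp (2 * \<i> * \<theta>)) = exp (- 2 * Im \<theta>) * (2 * sin (Re \<theta>) * cos (Re \<theta>))"
    by (simp_all add: Re_exp Im_exp sin_double)
  have "Re (exp (2 * \<i> * \<theta>)) < 1" if "cos (Re \<theta>) = 0"
  proof -
    have "cos (2 * Re \<theta>) = - 1" using that by (simp add: cos_double_cos)
    hence "Re (exp (2 * \<i> * \<theta>)) = - exp (- 2 * Im \<theta>)" unfolding Re by simp
    also have "\<dots> < 0" by simp
    finally show ?thesis by simp
  qed
  moreover have "Im (exp (2 * \<i> * \<theta>)) \<noteq> 0" if "cos (Re \<theta>) \<noteq> 0"
    unfolding Im using that assms by simp
  ultimately show ?thesis unfolding cut_plane_iff' by blast
qed

text \<open>
  The function \<open>u powr b * F(u\<^sup>2)\<close> for \<open>u = exp (\<i> \<theta>)\<close>, written so that it is also defined without ambiguity at \<open>- \<theta>\<close>.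
  The name refers to its expansion in the exponentials \<open>exp (\<i> (b + 2 k) \<theta>)\<close>.
\<close>

definition fourier_solution :: "complex \<Rightarrow> complex \<Rightarrow> complex \<Rightarrow> complex" where
  "fourier_solution a b \<theta> = exp (\<i> * b * \<theta>) * hyp2F1_reg a b (1 + b - a) (exp (2 * \<i> * \<theta>))"

definition fourier_solution' :: "complex \<Rightarrow> complex \<Rightarrow> complex \<Rightarrow> complex" where
  "fourier_solution' a b \<theta> = exp (\<i> * b * \<theta>) * (\<i> * (b * hyp2F1_reg a b (1 + b - a) (exp (2 * \<i> * \<theta>)) +
      2 * exp (2 * \<i> * \<theta>) * deriv (hyp2F1_reg a b (1 + b - a)) (exp (2 * \<i> * \<theta>))))"

text \<open>
  The change of variable \<open>w = exp (2 \<i> \<theta>)\<close> turns the hypergeometric equation into the Gegenbauer equation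
  \<open>y'' + 2 a cot \<theta> y' + b (b - 2 a) y = 0\<close>. The equation is invariant under \<open>\<theta> \<mapsto> - \<theta>\<close>, and the
  hypotheses are so chosen that the lemma can be applied at \<open>\<theta>\<close> and at \<open>- \<theta>\<close>.
\<close>

lemma fourier_solution_derivs:
  fixes a b \<theta> :: complex
  assumes "sin (Re \<theta>) \<noteq> 0" "sin \<theta> \<noteq> 0"
  shows "(fourier_solution a b has_field_derivative fourier_solution' a b \<theta>) (at \<theta>)"
    and "(fourier_solution' a b has_field_derivative
           (- 2 * a * cos \<theta> / sin \<theta>) * fourier_solution' a b \<theta> + (- b * (b - 2 * a)) * fourier_solution a b \<theta>) (at \<theta>)"
proof -
  define c where "c = 1 + b - a"
  define F where "F = hyp2F1_reg a b c"
  define w where "w = exp (2 * \<i> * \<theta>)"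
  define E where "E = exp (\<i> * b * \<theta>)"
  define F0 F1 F2 where "F0 = F w" and "F1 = deriv F w" and "F2 = deriv (deriv F) w"
  have cut: "w \<in> cut_plane" unfolding w_def by (rule exp_2i_in_cut_plane[OF assms(1)])
  have holF: "F holomorphic_on cut_plane" unfolding F_def by (rule holomorphic_hyp2F1_reg)
  have dw: "((\<lambda>t. exp (2 * \<i> * t)) has_field_derivative 2 * \<i> * w) (at \<theta>)"
    unfolding w_def by (auto intro!: derivative_eq_intros)
  have dE: "((\<lambda>t. exp (\<i> * b * t)) has_field_derivative \<i> * b * E) (at \<theta>)"
    unfolding E_def by (auto intro!: derivative_eq_intros)
  have dF: "((\<lambda>t. F (exp (2 * \<i> * t))) has_field_derivative F1 * (2 * \<i> * w)) (at \<theta>)"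
    using DERIV_chain2[OF holomorphic_derivI[OF holF open_cut_plane cut, unfolded w_def] dw]
    by (simp add: F1_def w_def)
  have dF': "((\<lambda>t. deriv F (exp (2 * \<i> * t))) has_field_derivative F2 * (2 * \<i> * w)) (at \<theta>)"
    using DERIV_chain2[OF holomorphic_derivI[OF holomorphic_deriv[OF holF open_cut_plane] open_cut_plane cut, unfolded w_def] dw]
    by (simp add: F2_def w_def)
  have val: "fourier_solution a b \<theta> = E * F0" "fourier_solution' a b \<theta> = E * (\<i> * (b * F0 + 2 * w * F1))"
    by (simp_all add: fourier_solution_def fourier_solution'_def E_def F0_def F1_def w_def F_def c_def)
  have "((\<lambda>t. exp (\<i> * b * t) * F (exp (2 * \<i> * t))) has_field_derivative
          \<i> * b * E * F0 + F1 * (2 * \<i> * w) * E) (at \<theta>)"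
    using DERIV_mult[OF dE dF] by (simp only: E_def F0_def w_def)
  hence "((\<lambda>t. exp (\<i> * b * t) * F (exp (2 * \<i> * t))) has_field_derivative E * (\<i> * (b * F0 + 2 * w * F1))) (at \<theta>)"
    by (rule DERIV_cong) (simp add: algebra_simps)
  thus "(fourier_solution a b has_field_derivative fourier_solution' a b \<theta>) (at \<theta>)"
    unfolding val(2) by (simp add: fourier_solution_def[abs_def] F_def c_def)
  have d1: "((\<lambda>t. \<i> * (b * F (exp (2 * \<i> * t)) + 2 * exp (2 * \<i> * t) * deriv F (exp (2 * \<i> * t)))) has_field_derivative
          \<i> * (b * (F1 * (2 * \<i> * w)) + (2 * (2 * \<i> * w) * F1 + F2 * (2 * \<i> * w) * (2 * w)))) (at \<theta>)"
    using DERIV_cmult[OF DERIV_add[OF DERIV_cmult[OF dF, of b] DERIV_mult[OF DERIV_cmult[OF dw, of 2] dF']], of \<i>]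
    by (simp only: F1_def w_def)
  have "((\<lambda>t. exp (\<i> * b * t) * (\<i> * (b * F (exp (2 * \<i> * t)) + 2 * exp (2 * \<i> * t) * deriv F (exp (2 * \<i> * t)))))
          has_field_derivative - E * (b^2 * F0 + 4 * (b + 1) * w * F1 + 4 * w^2 * F2)) (at \<theta>)"
    by (rule DERIV_cong[OF DERIV_mult[OF dE d1]])
       (simp only: F0_def F1_def F2_def w_def[symmetric] E_def[symmetric], simp add: algebra_simps power2_eq_square)
  hence "(fourier_solution' a b has_field_derivative - E * (b^2 * F0 + 4 * (b + 1) * w * F1 + 4 * w^2 * F2)) (at \<theta>)"
    by (simp add: fourier_solution'_def[abs_def] F_def c_def)
  also have "- E * (b^2 * F0 + 4 * (b + 1) * w * F1 + 4 * w^2 * F2) =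
     (- 2 * a * cos \<theta> / sin \<theta>) * fourier_solution' a b \<theta> + (- b * (b - 2 * a)) * fourier_solution a b \<theta>"
  proof -
    \<comment> \<open>After multiplication by \<open>w - 1\<close> the difference of the two sides is \<open>4 w\<close> times the hypergeometric equation.\<close>
    have ode: "w * (1 - w) * F2 + (c - (a + b + 1) * w) * F1 - a * b * F0 = 0"
      unfolding F0_def F1_def F2_def F_def by (rule hyp2F1_reg_ode[OF cut])
    have "w = exp (\<i> * \<theta>) * exp (\<i> * \<theta>)" unfolding w_def by (simp add: mult.assoc flip: exp_add)
    hence sc: "2 * \<i> * sin \<theta> * exp (\<i> * \<theta>) = w - 1" "2 * cos \<theta> * exp (\<i> * \<theta>) = w + 1"
      by (simp_all add: sin_exp_eq cos_exp_eq exp_minus field_simps)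
    have "w \<noteq> 1" using cut by (auto simp: cut_plane_iff')
    have "cos \<theta> / sin \<theta> = (2 * cos \<theta> * exp (\<i> * \<theta>)) * \<i> / (2 * \<i> * sin \<theta> * exp (\<i> * \<theta>))"
      using assms(2) by (simp add: field_simps)
    also have "\<dots> = \<i> * (w + 1) / (w - 1)" unfolding sc by (simp only: mult.commute)
    finally have cot: "cos \<theta> / sin \<theta> = \<i> * (w + 1) / (w - 1)" .
    define Z where "Z = 2 * a * (w + 1) / (w - 1) * (b * F0 + 2 * w * F1)"
    have "(w - 1) * (b^2 * F0 + 4 * (b + 1) * w * F1 + 4 * w^2 * F2) =
       - (2 * a * (w + 1) * (b * F0 + 2 * w * F1)) + (w - 1) * (b * (b - 2 * a) * F0)
       - 4 * w * (w * (1 - w) * F2 + (c - (a + b + 1) * w) * F1 - a * b * F0)"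
      unfolding c_def by (simp add: algebra_simps power2_eq_square)
    hence "b^2 * F0 + 4 * (b + 1) * w * F1 + 4 * w^2 * F2 =
       - (2 * a * (w + 1) / (w - 1) * (b * F0 + 2 * w * F1)) + b * (b - 2 * a) * F0"
      unfolding ode using \<open>w \<noteq> 1\<close> by (simp add: field_simps)
    hence eq1: "b^2 * F0 + 4 * (b + 1) * w * F1 + 4 * w^2 * F2 = - Z + b * (b - 2 * a) * F0"
      unfolding Z_def .
    have "(- 2 * a * cos \<theta> / sin \<theta>) * fourier_solution' a b \<theta> =
        - 2 * a * (cos \<theta> / sin \<theta>) * (E * (\<i> * (b * F0 + 2 * w * F1)))"
      unfolding val by simp
    also have "\<dots> = - (\<i> * \<i>) * (E * Z)"
      unfolding cot Z_def by (simp only: divide_inverse mult_ac mult_minus_left mult_minus_right)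
    finally have eq2: "(- 2 * a * cos \<theta> / sin \<theta>) * fourier_solution' a b \<theta> = E * Z" by simp
    show ?thesis unfolding val(1) eq1 eq2 by (simp add: algebra_simps)
  qed
  finally show "(fourier_solution' a b has_field_derivative
           (- 2 * a * cos \<theta> / sin \<theta>) * fourier_solution' a b \<theta> + (- b * (b - 2 * a)) * fourier_solution a b \<theta>) (at \<theta>)" .
qed

lemma Re_cos_pos:
  assumes "\<bar>Re z\<bar> < pi / 2"
  shows "Re (cos z) > 0"
proof -
  have "cos (Re z) > 0" using assms by (intro cos_gt_zero_pi) auto
  thus ?thesis by (simp add: Re_cos add_pos_pos)
qed

lemma square_notin_nonpos_Reals:
  fixes z :: complex
  assumes "Re z > 0"
  shows "z\<^sup>2 \<notin> \<real>\<^sub>\<le>\<^sub>0"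
proof
  assume "z\<^sup>2 \<in> \<real>\<^sub>\<le>\<^sub>0"
  hence 1: "Re (z\<^sup>2) \<le> 0" "Im (z\<^sup>2) = 0" by (simp_all add: complex_nonpos_Reals_iff)
  have "Im z = 0" using 1(2) assms by (simp add: power2_eq_square)
  hence "Re (z\<^sup>2) = (Re z)\<^sup>2" by (simp add: power2_eq_square)
  moreover have "(Re z)\<^sup>2 > 0" using assms by simp
  ultimately show False using 1(1) by linarith
qed

text \<open>
  Up to a power of \<open>2\<close> this is the Ferrers function of \<open>cos \<theta>\<close> divided by \<open>(sin \<theta>) powr \<mu>\<close>; see \<open>ferrersP_cos\<close>. The
  variable is \<open>(sin (\<theta>/2))\<^sup>2 = (1 - cos \<theta>)/2\<close>.
\<close>

definition half_angle_solution :: "complex \<Rightarrow> complex \<Rightarrow> complex \<Rightarrow> complex" where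
  "half_angle_solution \<nu> \<mu> \<theta> =
     exp (- 2 * \<mu> * Ln (sin (\<theta> / 2))) * hyp2F1_reg (\<nu> + 1) (- \<nu>) (1 - \<mu>) ((sin (\<theta> / 2))\<^sup>2)"

definition half_angle_solution' :: "complex \<Rightarrow> complex \<Rightarrow> complex \<Rightarrow> complex" where
  "half_angle_solution' \<nu> \<mu> \<theta> = exp (- 2 * \<mu> * Ln (sin (\<theta> / 2))) *
     (- \<mu> * (cos (\<theta> / 2) / sin (\<theta> / 2)) * hyp2F1_reg (\<nu> + 1) (- \<nu>) (1 - \<mu>) ((sin (\<theta> / 2))\<^sup>2)
      + sin (\<theta> / 2) * cos (\<theta> / 2) * deriv (hyp2F1_reg (\<nu> + 1) (- \<nu>) (1 - \<mu>)) ((sin (\<theta> / 2))\<^sup>2))"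

text \<open>
  The same Gegenbauer equation as for \<open>fourier_solution\<close> with \<open>a = \<mu> + 1/2\<close> and \<open>b = \<nu> + \<mu> + 1\<close>. The singular terms that
  the factor \<open>exp (- 2 \<mu> Ln s)\<close> produces cancel, and what is left is the hypergeometric equation at \<open>s\<^sup>2\<close>.
\<close>

lemma half_angle_solution_derivs:
  fixes \<nu> \<mu> \<theta> :: complex
  assumes \<theta>: "0 < Re \<theta>" "Re \<theta> < pi"
  shows "(half_angle_solution \<nu> \<mu> has_field_derivative half_angle_solution' \<nu> \<mu> \<theta>) (at \<theta>)"
    and "(half_angle_solution' \<nu> \<mu> has_field_derivative
           (- (2 * \<mu> + 1) * cos \<theta> / sin \<theta>) * half_angle_solution' \<nu> \<mu> \<theta> +
           (- (\<nu> + \<mu> + 1) * (\<nu> - \<mu>)) * half_angle_solution \<nu> \<mu> \<theta>) (at \<theta>)"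
proof -
  define H where "H = hyp2F1_reg (\<nu> + 1) (- \<nu>) (1 - \<mu>)"
  define s k where "s = sin (\<theta> / 2)" and "k = cos (\<theta> / 2)"
  define E where "E = exp (- 2 * \<mu> * Ln s)"
  define H0 H1 H2 where "H0 = H (s\<^sup>2)" and "H1 = deriv H (s\<^sup>2)" and "H2 = deriv (deriv H) (s\<^sup>2)"
  have "Re s > 0" unfolding s_def using \<theta> by (intro Re_sin_pos) auto
  hence s: "s \<notin> \<real>\<^sub>\<le>\<^sub>0" "s \<noteq> 0" by (auto simp: complex_nonpos_Reals_iff)
  have "Re k > 0" unfolding k_def using \<theta> by (intro Re_cos_pos) auto
  hence k: "k\<^sup>2 \<notin> \<real>\<^sub>\<le>\<^sub>0" "k \<noteq> 0" using square_notin_nonpos_Reals[of k] by auto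
  have sk: "k\<^sup>2 = 1 - s\<^sup>2" unfolding s_def k_def by (rule cos_squared_eq)
  have cut: "s\<^sup>2 \<in> cut_plane" unfolding cut_plane_iff sk[symmetric] by (rule k(1))
  have holH: "H holomorphic_on cut_plane" unfolding H_def by (rule holomorphic_hyp2F1_reg)
  have ds: "((\<lambda>t. sin (t / 2)) has_field_derivative k / 2) (at \<theta>)"
    unfolding k_def by (auto intro!: derivative_eq_intros)
  have dk: "((\<lambda>t. cos (t / 2)) has_field_derivative - s / 2) (at \<theta>)"
    unfolding s_def by (auto intro!: derivative_eq_intros)
  have dw: "((\<lambda>t. (sin (t / 2))\<^sup>2) has_field_derivative s * k) (at \<theta>)"
    using DERIV_power[OF ds, of 2] by (simp add: s_def[symmetric] mult_ac)
  have dE: "((\<lambda>t. exp (- 2 * \<mu> * Ln (sin (t / 2)))) has_field_derivative E * (- \<mu> * (k / s))) (at \<theta>)"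
  proof -
    have "((\<lambda>t. Ln (sin (t / 2))) has_field_derivative inverse s * (k / 2)) (at \<theta>)"
      using DERIV_chain2[OF has_field_derivative_Ln[OF s(1), unfolded s_def] ds] by (simp add: s_def)
    from DERIV_chain2[OF DERIV_exp DERIV_cmult[OF this, of "- 2 * \<mu>"]]
    show ?thesis by (rule DERIV_cong) (simp add: E_def s_def[symmetric] field_simps)
  qed
  have dH: "((\<lambda>t. H ((sin (t / 2))\<^sup>2)) has_field_derivative H1 * (s * k)) (at \<theta>)"
    using DERIV_chain2[OF holomorphic_derivI[OF holH open_cut_plane cut, unfolded s_def] dw]
    by (simp add: H1_def s_def)
  have dH': "((\<lambda>t. deriv H ((sin (t / 2))\<^sup>2)) has_field_derivative H2 * (s * k)) (at \<theta>)"
    using DERIV_chain2[OF holomorphic_derivI[OF holomorphic_deriv[OF holH open_cut_plane] open_cut_plane cut, unfolded s_def] dw]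
    by (simp add: H2_def s_def)
  have val: "half_angle_solution \<nu> \<mu> \<theta> = E * H0"
    "half_angle_solution' \<nu> \<mu> \<theta> = E * (- \<mu> * (k / s) * H0 + s * k * H1)"
    by (simp_all add: half_angle_solution_def half_angle_solution'_def E_def H0_def H1_def H_def s_def k_def)
  have "((\<lambda>t. exp (- 2 * \<mu> * Ln (sin (t / 2))) * H ((sin (t / 2))\<^sup>2)) has_field_derivative
          E * (- \<mu> * (k / s) * H0 + s * k * H1)) (at \<theta>)"
    by (rule DERIV_cong[OF DERIV_mult[OF dE dH]])
       (simp only: H0_def s_def[symmetric] E_def[symmetric], simp add: algebra_simps)
  thus "(half_angle_solution \<nu> \<mu> has_field_derivative half_angle_solution' \<nu> \<mu> \<theta>) (at \<theta>)"
    unfolding val(2) by (simp add: half_angle_solution_def[abs_def] H_def)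
  have dcot: "((\<lambda>t. cos (t / 2) / sin (t / 2)) has_field_derivative - 1 / (2 * s\<^sup>2)) (at \<theta>)"
  proof (rule DERIV_cong[OF DERIV_divide[OF dk ds]])
    show "sin (\<theta> / 2) \<noteq> 0" using s by (simp add: s_def)
    have "(- s / 2 * s - k * (k / 2)) = - (s\<^sup>2 + k\<^sup>2) / 2" by (simp add: power2_eq_square field_simps)
    also have "s\<^sup>2 + k\<^sup>2 = 1" using sk by simp
    finally have eq: "- s / 2 * s - k * (k / 2) = - 1 / 2" .
    show "(- s / 2 * sin (\<theta> / 2) - cos (\<theta> / 2) * (k / 2)) / (sin (\<theta> / 2) * sin (\<theta> / 2)) = - 1 / (2 * s\<^sup>2)"
      unfolding s_def[symmetric] k_def[symmetric] eq by (simp add: power2_eq_square)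
  qed
  have dsk: "((\<lambda>t. sin (t / 2) * cos (t / 2)) has_field_derivative (k\<^sup>2 - s\<^sup>2) / 2) (at \<theta>)"
    by (rule DERIV_cong[OF DERIV_mult[OF ds dk]])
       (simp only: s_def[symmetric] k_def[symmetric], simp add: field_simps power2_eq_square)
  note dT = DERIV_add[OF DERIV_mult[OF DERIV_cmult[OF dcot, of "- \<mu>"] dH] DERIV_mult[OF dsk dH']]
  define T where "T = (\<mu>\<^sup>2 * k\<^sup>2 / s\<^sup>2 + \<mu> / (2 * s\<^sup>2)) * H0 + (- 2 * \<mu> * k\<^sup>2 + (k\<^sup>2 - s\<^sup>2) / 2) * H1 + s\<^sup>2 * k\<^sup>2 * H2"
  have "((\<lambda>t. exp (- 2 * \<mu> * Ln (sin (t / 2))) * (- \<mu> * (cos (t / 2) / sin (t / 2)) * H ((sin (t / 2))\<^sup>2)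
           + sin (t / 2) * cos (t / 2) * deriv H ((sin (t / 2))\<^sup>2))) has_field_derivative E * T) (at \<theta>)"
    by (rule DERIV_cong[OF DERIV_mult[OF dE dT]])
       (simp only: H0_def[symmetric] H1_def[symmetric] s_def[symmetric] k_def[symmetric] E_def[symmetric] T_def,
        use s in \<open>simp add: field_simps power2_eq_square\<close>)
  hence "(half_angle_solution' \<nu> \<mu> has_field_derivative E * T) (at \<theta>)"
    by (simp add: half_angle_solution'_def[abs_def] H_def)
  also have "E * T = (- (2 * \<mu> + 1) * cos \<theta> / sin \<theta>) * half_angle_solution' \<nu> \<mu> \<theta> +
           (- (\<nu> + \<mu> + 1) * (\<nu> - \<mu>)) * half_angle_solution \<nu> \<mu> \<theta>"
  proof -
    have ode: "s\<^sup>2 * (1 - s\<^sup>2) * H2 + (1 - \<mu> - 2 * s\<^sup>2) * H1 + \<nu> * (\<nu> + 1) * H0 = 0"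
      using hyp2F1_reg_ode[OF cut, of "\<nu> + 1" "- \<nu>" "1 - \<mu>"]
      by (simp add: H0_def H1_def H2_def H_def algebra_simps)
    have "cos \<theta> = k\<^sup>2 - s\<^sup>2" "sin \<theta> = 2 * s * k"
      using cos_double[of "\<theta> / 2"] sin_double[of "\<theta> / 2"] by (simp_all add: s_def k_def)
    hence cot: "- (2 * \<mu> + 1) * cos \<theta> / sin \<theta> = - (2 * \<mu> + 1) * (k\<^sup>2 - s\<^sup>2) / (2 * s * k)" by simp
    have split: "(- (2 * \<mu> + 1) * (k\<^sup>2 - s\<^sup>2) / (2 * s * k)) * (- \<mu> * (k / s) * H0 + s * k * H1) =
       \<mu> * (2 * \<mu> + 1) * (k\<^sup>2 - s\<^sup>2) / (2 * s\<^sup>2) * H0 - (2 * \<mu> + 1) * (k\<^sup>2 - s\<^sup>2) / 2 * H1"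
      using s k by (simp add: field_simps power2_eq_square)
    have c0: "\<mu>\<^sup>2 * k\<^sup>2 / s\<^sup>2 + \<mu> / (2 * s\<^sup>2) - \<mu> * (2 * \<mu> + 1) * (k\<^sup>2 - s\<^sup>2) / (2 * s\<^sup>2) = \<mu>\<^sup>2 + \<mu>"
      unfolding sk using s by (simp add: field_simps power2_eq_square)
    have c1: "- 2 * \<mu> * k\<^sup>2 + (k\<^sup>2 - s\<^sup>2) / 2 + (2 * \<mu> + 1) * (k\<^sup>2 - s\<^sup>2) / 2 = 1 - \<mu> - 2 * s\<^sup>2"
      unfolding sk by (simp add: field_simps)
    have "T - (\<mu> * (2 * \<mu> + 1) * (k\<^sup>2 - s\<^sup>2) / (2 * s\<^sup>2) * H0 - (2 * \<mu> + 1) * (k\<^sup>2 - s\<^sup>2) / 2 * H1)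
       = (\<mu>\<^sup>2 * k\<^sup>2 / s\<^sup>2 + \<mu> / (2 * s\<^sup>2) - \<mu> * (2 * \<mu> + 1) * (k\<^sup>2 - s\<^sup>2) / (2 * s\<^sup>2)) * H0
         + (- 2 * \<mu> * k\<^sup>2 + (k\<^sup>2 - s\<^sup>2) / 2 + (2 * \<mu> + 1) * (k\<^sup>2 - s\<^sup>2) / 2) * H1 + s\<^sup>2 * k\<^sup>2 * H2"
      unfolding T_def by (simp only: ring_distribs) simp
    also have "\<dots> = (\<mu>\<^sup>2 + \<mu>) * H0 + ((1 - \<mu> - 2 * s\<^sup>2) * H1 + s\<^sup>2 * (1 - s\<^sup>2) * H2)"
      unfolding c0 c1 by (simp add: sk)
    also have "(1 - \<mu> - 2 * s\<^sup>2) * H1 + s\<^sup>2 * (1 - s\<^sup>2) * H2 = - (\<nu> * (\<nu> + 1) * H0)"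
      using ode by (simp add: algebra_simps eq_neg_iff_add_eq_0)
    also have "(\<mu>\<^sup>2 + \<mu>) * H0 + - (\<nu> * (\<nu> + 1) * H0) = (- (\<nu> + \<mu> + 1) * (\<nu> - \<mu>)) * H0"
      by (simp add: algebra_simps power2_eq_square)
    finally have T: "T = (- (2 * \<mu> + 1) * (k\<^sup>2 - s\<^sup>2) / (2 * s * k)) * (- \<mu> * (k / s) * H0 + s * k * H1) +
       (- (\<nu> + \<mu> + 1) * (\<nu> - \<mu>)) * H0"
      unfolding split by (simp only: diff_eq_eq add.commute)
    have "E * (p * y + q * h) = p * (E * y) + q * (E * h)" for p y q h :: complex
      by (simp add: algebra_simps)
    thus ?thesis unfolding val cot T by blast
  qed
  finally show "(half_angle_solution' \<nu> \<mu> has_field_derivative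
           (- (2 * \<mu> + 1) * cos \<theta> / sin \<theta>) * half_angle_solution' \<nu> \<mu> \<theta> +
           (- (\<nu> + \<mu> + 1) * (\<nu> - \<mu>)) * half_angle_solution \<nu> \<mu> \<theta>) (at \<theta>)" .
qed

section \<open>Agreement of the initial values\<close>

lemma half_notin_nonpos_Ints:
  fixes b :: complex
  assumes "b \<notin> \<int>\<^sub>\<le>\<^sub>0"
  shows "b / 2 \<notin> \<int>\<^sub>\<le>\<^sub>0" "(b + 1) / 2 \<notin> \<int>\<^sub>\<le>\<^sub>0"
proof -
  show "b / 2 \<notin> \<int>\<^sub>\<le>\<^sub>0"
  proof
    assume "b / 2 \<in> \<int>\<^sub>\<le>\<^sub>0"
    then obtain n where n: "b / 2 = - of_nat n" by (auto elim!: nonpos_Ints_cases')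
    have "b = 2 * (b / 2)" by simp
    also have "\<dots> = - of_nat (2 * n)" unfolding n by simp
    also have "\<dots> \<in> \<int>\<^sub>\<le>\<^sub>0" by (rule minus_of_nat_in_nonpos_Ints)
    finally show False using assms by contradiction
  qed
  show "(b + 1) / 2 \<notin> \<int>\<^sub>\<le>\<^sub>0"
  proof
    assume "(b + 1) / 2 \<in> \<int>\<^sub>\<le>\<^sub>0"
    then obtain n where n: "(b + 1) / 2 = - of_nat n" by (auto elim!: nonpos_Ints_cases')
    have "x = 2 * (x / 2)" for x :: complex by simp
    from this[of "b + 1"] have "b + 1 = 2 * (- of_nat n)" unfolding n .
    hence "b = 2 * (- of_nat n) - 1" by (simp only: eq_diff_eq)
    also have "\<dots> = - of_nat (2 * n + 1)" by simp
    also have "\<dots> \<in> \<int>\<^sub>\<le>\<^sub>0" by (rule minus_of_nat_in_nonpos_Ints)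
    finally show False using assms by contradiction
  qed
qed

lemma Gamma_times_sin:
  fixes z :: complex
  assumes "z \<notin> \<int>\<^sub>\<le>\<^sub>0"
  shows "Gamma z * sin (of_real pi * z) = of_real pi * rGamma (1 - z)"
proof (cases "1 - z \<in> \<int>\<^sub>\<le>\<^sub>0")
  case True
  then obtain n where "1 - z = - of_nat n" by (auto elim!: nonpos_Ints_cases')
  hence z: "z = of_nat (n + 1)" by (simp add: algebra_simps)
  have "sin (of_real pi * z) = 0"
    unfolding z sin_eq_0 by (rule exI[of _ "int (n + 1)"]) (simp add: mult.commute)
  thus ?thesis using True by (simp add: rGamma_eq_zero_iff)
next
  case False
  have g: "Gamma z \<noteq> 0" "Gamma (1 - z) \<noteq> 0" using assms False by (simp_all add: Gamma_eq_zero_iff)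
  hence "sin (of_real pi * z) \<noteq> 0"
    using Gamma_reflection_complex[of z] by auto
  thus ?thesis
    using Gamma_reflection_complex[of z] g by (simp add: rGamma_inverse_Gamma field_simps)
qed

text \<open>
  Legendre's duplication formula splits \<open>\<Gamma>(b)\<close> into \<open>\<Gamma>(b/2) \<Gamma>((b+1)/2)\<close>; one factor is cancelled by the
  reciprocal Gamma value, and the reflection formula absorbs the sine or cosine into the other.
\<close>

lemma Gamma_times_trig_half:
  fixes b :: complex
  assumes b: "b \<notin> \<int>\<^sub>\<le>\<^sub>0"
  shows "Gamma b * rGamma ((b + 1) / 2) * sin (of_real pi * b / 2) =
           2 powr (b - 1) * of_real (sqrt pi) * rGamma (1 - b / 2)"
    and "Gamma b * rGamma (b / 2) * cos (of_real pi * b / 2) =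
           2 powr (b - 1) * of_real (sqrt pi) * rGamma ((1 - b) / 2)"
proof -
  note h = half_notin_nonpos_Ints[OF b]
  define G1 G2 where "G1 = Gamma (b / 2)" and "G2 = Gamma ((b + 1) / 2)"
  have nz: "G1 \<noteq> 0" "G2 \<noteq> 0" using h by (simp_all add: G1_def G2_def Gamma_eq_zero_iff)
  have "Ln 2 = of_real (ln 2)" using Ln_of_real[of 2] by simp
  hence e: "exp ((1 - b) * of_real (ln 2)) = 2 powr (1 - b)" by (simp add: powr_def)
  have half: "b / 2 + 1 / 2 = (b + 1) / 2" by (simp add: add_divide_distrib)
  have "G1 * G2 = exp ((1 - 2 * (b / 2)) * of_real (ln 2)) * of_real (sqrt pi) * Gamma (2 * (b / 2))"
    unfolding G1_def G2_def by (rule Gamma_legendre_duplication[of "b / 2", unfolded half, OF h])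
  hence "G1 * G2 = 2 powr (1 - b) * of_real (sqrt pi) * Gamma b"
    using e by simp
  hence "2 powr (b - 1) * (G1 * G2) = 2 powr (b - 1) * 2 powr (1 - b) * of_real (sqrt pi) * Gamma b"
    by simp
  also have "2 powr (b - 1) * 2 powr (1 - b) = (1 :: complex)"
    by (simp flip: powr_add)
  finally have "of_real (sqrt pi) * Gamma b = 2 powr (b - 1) * (G1 * G2)" by simp
  moreover have pi: "of_real (sqrt pi) * of_real (sqrt pi) = complex_of_real pi"
    by (simp flip: of_real_mult)
  ultimately have dup: "Gamma b * of_real pi = 2 powr (b - 1) * of_real (sqrt pi) * (G1 * G2)"
    by (metis mult.assoc mult.commute)
  have "of_real pi * (Gamma b * rGamma ((b + 1) / 2) * sin (of_real pi * b / 2)) =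
     (Gamma b * of_real pi) * rGamma ((b + 1) / 2) * sin (of_real pi * b / 2)" by (simp only: mult_ac)
  also have "\<dots> = 2 powr (b - 1) * of_real (sqrt pi) * (G1 * sin (of_real pi * (b / 2)))"
    unfolding dup using nz by (simp add: rGamma_inverse_Gamma G2_def[symmetric])
  also have "G1 * sin (of_real pi * (b / 2)) = of_real pi * rGamma (1 - b / 2)"
    unfolding G1_def by (rule Gamma_times_sin[OF h(1)])
  finally show "Gamma b * rGamma ((b + 1) / 2) * sin (of_real pi * b / 2) =
           2 powr (b - 1) * of_real (sqrt pi) * rGamma (1 - b / 2)" by (simp add: mult.assoc)
  have c: "cos (of_real pi * b / 2) = sin (of_real pi * ((b + 1) / 2))"
    by (subst cos_sin_eq[of "- (of_real pi * b / 2)", simplified]) (simp add: field_simps)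
  have "of_real pi * (Gamma b * rGamma (b / 2) * cos (of_real pi * b / 2)) =
     (Gamma b * of_real pi) * rGamma (b / 2) * cos (of_real pi * b / 2)" by (simp only: mult_ac)
  also have "\<dots> = 2 powr (b - 1) * of_real (sqrt pi) * (G2 * sin (of_real pi * ((b + 1) / 2)))"
    unfolding dup c using nz by (simp add: rGamma_inverse_Gamma G1_def[symmetric])
  also have "G2 * sin (of_real pi * ((b + 1) / 2)) = of_real pi * rGamma (1 - (b + 1) / 2)"
    unfolding G2_def by (rule Gamma_times_sin[OF h(2)])
  also have "1 - (b + 1) / 2 = (1 - b) / 2"
  proof -
    have "1 - x / 2 = (2 - x) / 2" for x :: complex by (simp add: diff_divide_distrib)
    moreover have "2 - (b + 1) = 1 - b" by simp
    ultimately show ?thesis by (simp only:)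
  qed
  finally show "Gamma b * rGamma (b / 2) * cos (of_real pi * b / 2) =
           2 powr (b - 1) * of_real (sqrt pi) * rGamma ((1 - b) / 2)" by (simp add: mult.assoc)
qed

lemma half_angle_solution_at_half_pi:
  "half_angle_solution \<nu> \<mu> (of_real (pi / 2)) = 2 powr \<mu> * hyp2F1_reg (\<nu> + 1) (- \<nu>) (1 - \<mu>) (1/2)"
  "half_angle_solution' \<nu> \<mu> (of_real (pi / 2)) = 2 powr \<mu> * hyp2F1_reg (\<nu> + 1) (- \<nu>) (- \<mu>) (1/2)"
proof -
  define s where "s = complex_of_real (sin (pi / 4))"
  have sin: "sin (of_real (pi / 2) / 2) = s" and cos: "cos (of_real (pi / 2) / 2) = s"
  proof -
    have arg: "complex_of_real (pi / 2) / 2 = of_real (pi / 4)" by simp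
    show "sin (of_real (pi / 2) / 2) = s" unfolding arg s_def by (rule sin_of_real)
    have "cos (pi / 4) = sin (pi / 4)" by (simp add: sin_45 cos_45)
    thus "cos (of_real (pi / 2) / 2) = s" unfolding arg s_def by (simp only: cos_of_real)
  qed
  have s2: "s\<^sup>2 = 1 / 2"
    by (simp add: s_def sin_45 power_divide flip: of_real_power)
  have "sin (pi / 4) > 0" by (simp add: sin_45)
  have "Ln s = of_real (ln (sin (pi / 4)))"
    unfolding s_def by (rule Ln_of_real) fact
  also have "ln (sin (pi / 4)) = - ln 2 / 2"
    by (simp add: sin_45 ln_div ln_sqrt)
  finally have "exp (- 2 * \<mu> * Ln s) = exp (\<mu> * of_real (ln 2))" by simp
  moreover have "Ln 2 = of_real (ln 2)" using Ln_of_real[of 2] by simp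
  ultimately have E: "exp (- 2 * \<mu> * Ln s) = 2 powr \<mu>" by (simp add: powr_def)
  show "half_angle_solution \<nu> \<mu> (of_real (pi / 2)) = 2 powr \<mu> * hyp2F1_reg (\<nu> + 1) (- \<nu>) (1 - \<mu>) (1/2)"
    unfolding half_angle_solution_def sin s2 E ..
  have "s \<noteq> 0" using s2 by auto
  hence ss: "s / s = 1" "s * s = 1 / 2" using s2 by (simp_all add: power2_eq_square)
  show "half_angle_solution' \<nu> \<mu> (of_real (pi / 2)) = 2 powr \<mu> * hyp2F1_reg (\<nu> + 1) (- \<nu>) (- \<mu>) (1/2)"
    unfolding half_angle_solution'_def sin cos s2 E ss
    using hyp2F1_reg_lower_c[OF half_in_cut_plane, of "\<nu> + 1" "- \<nu>" "- \<mu>"]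
    by simp
qed

lemma fourier_solution_at_half_pi:
  "fourier_solution a b (of_real (pi / 2)) - fourier_solution a b (- of_real (pi / 2)) =
     2 * \<i> * sin (of_real pi * b / 2) * (2 powr (- a) * hyp2F1_reg a (1 - a) (1 + b - a) (1/2))"
  "fourier_solution' a b (of_real (pi / 2)) + fourier_solution' a b (- of_real (pi / 2)) =
     2 * \<i> * cos (of_real pi * b / 2) * (2 powr (- a) * hyp2F1_reg a (1 - a) (b - a) (1/2))"
proof -
  have e: "exp (2 * \<i> * of_real (pi / 2)) = - 1" "exp (2 * \<i> * - of_real (pi / 2)) = - 1"
    by (simp_all add: exp_minus mult.commute[of \<i>])
  have b: "\<i> * b * of_real (pi / 2) = \<i> * (of_real pi * b / 2)"
     "\<i> * b * - of_real (pi / 2) = - (\<i> * (of_real pi * b / 2))" by simp_all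
  have sc: "exp (\<i> * (of_real pi * b / 2)) - exp (- (\<i> * (of_real pi * b / 2))) = 2 * \<i> * sin (of_real pi * b / 2)"
    "exp (\<i> * (of_real pi * b / 2)) + exp (- (\<i> * (of_real pi * b / 2))) = 2 * cos (of_real pi * b / 2)"
    by (simp_all add: sin_exp_eq cos_exp_eq)
  show "fourier_solution a b (of_real (pi / 2)) - fourier_solution a b (- of_real (pi / 2)) =
     2 * \<i> * sin (of_real pi * b / 2) * (2 powr (- a) * hyp2F1_reg a (1 - a) (1 + b - a) (1/2))"
    unfolding fourier_solution_def e b hyp2F1_reg_minus_one[OF refl]
    unfolding left_diff_distrib[symmetric] sc ..
  have "b * hyp2F1_reg a b (1 + b - a) (- 1) + 2 * - 1 * deriv (hyp2F1_reg a b (1 + b - a)) (- 1) =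
      2 powr (- a) * hyp2F1_reg a (1 - a) (b - a) (1/2)"
    using deriv_hyp2F1_reg_minus_one[of "1 + b - a" b a] by simp
  thus "fourier_solution' a b (of_real (pi / 2)) + fourier_solution' a b (- of_real (pi / 2)) =
     2 * \<i> * cos (of_real pi * b / 2) * (2 powr (- a) * hyp2F1_reg a (1 - a) (b - a) (1/2))"
    unfolding fourier_solution'_def e b
    unfolding distrib_right[symmetric] sc by simp
qed

text \<open>
  At \<open>\<theta> = \<pi>/2\<close> the argument of the half-angle solution is \<open>1/2\<close>, and both exponentials \<open>exp (\<plusminus> 2 \<i> \<theta>)\<close> equal \<open>-1\<close>. All
  values and derivatives are thus given by Bailey's theorem, and the comparison is one of Gamma factors and
  powers of \<open>2\<close>.
\<close>

lemma solutions_agree_at_half_pi: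
  fixes \<nu> \<mu> :: complex
  defines "a \<equiv> \<mu> + 1 / 2" and "b \<equiv> \<nu> + \<mu> + 1"
  defines "C \<equiv> 2 powr \<mu> * 2 powr \<mu> / (\<i> * of_real (sqrt pi)) * Gamma b"
  assumes b: "b \<notin> \<int>\<^sub>\<le>\<^sub>0"
  shows "half_angle_solution \<nu> \<mu> (of_real (pi / 2)) =
      C * (fourier_solution a b (of_real (pi / 2)) - fourier_solution a b (- of_real (pi / 2)))"
    and "half_angle_solution' \<nu> \<mu> (of_real (pi / 2)) =
      C * (fourier_solution' a b (of_real (pi / 2)) + fourier_solution' a b (- of_real (pi / 2)))"
proof -
  define P where "P = complex_of_real (sqrt pi)"
  have P: "P \<noteq> 0" by (simp add: P_def)
  have 1: "hyp2F1_reg (\<nu> + 1) (- \<nu>) (1 - \<mu>) (1/2) = 2 powr \<mu> * P * rGamma (1 - b / 2) * rGamma ((\<nu> - \<mu>) / 2 + 1)"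
  proof -
    have e: "(1 - \<mu> + 1 - (\<nu> + 1)) / 2 = 1 - b / 2" "(1 - \<mu> + (\<nu> + 1)) / 2 = (\<nu> - \<mu>) / 2 + 1"
      "1 - (\<nu> + 1) = - \<nu>" "1 - (1 - \<mu>) = \<mu>"
      by (simp_all add: b_def field_simps)
    show ?thesis unfolding hyp2F1_reg_half[of "\<nu> + 1" "1 - \<mu>", unfolded e] P_def by (simp only: mult_ac)
  qed
  have 2: "hyp2F1_reg (\<nu> + 1) (- \<nu>) (- \<mu>) (1/2) = 2 * 2 powr \<mu> * P * rGamma ((1 - b) / 2) * rGamma ((\<nu> - \<mu> + 1) / 2)"
  proof -
    have e: "(- \<mu> + 1 - (\<nu> + 1)) / 2 = (1 - b) / 2" "(- \<mu> + (\<nu> + 1)) / 2 = (\<nu> - \<mu> + 1) / 2"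
      "1 - (\<nu> + 1) = - \<nu>" "1 - (- \<mu>) = 1 + \<mu>"
      by (simp_all add: b_def field_simps)
    have pw: "2 powr (1 + \<mu>) = 2 * (2 powr \<mu> :: complex)" by (simp add: powr_add)
    show ?thesis unfolding hyp2F1_reg_half[of "\<nu> + 1" "- \<mu>", unfolded e] P_def pw by (simp only: mult_ac)
  qed
  have 3: "2 powr (- a) * hyp2F1_reg a (1 - a) (1 + b - a) (1/2) =
      2 powr (- b) * P * rGamma ((b + 1) / 2) * rGamma ((\<nu> - \<mu>) / 2 + 1)"
  proof -
    have e: "(1 + b - a + a) / 2 = (b + 1) / 2" "(1 + b - a + 1 - a) / 2 = (\<nu> - \<mu>) / 2 + 1"
      by (simp_all add: a_def b_def field_simps)
    have pw: "(2 powr (- b) :: complex) = 2 powr (- a) * 2 powr (1 - (1 + b - a))"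
      by (simp flip: powr_add)
    show ?thesis unfolding hyp2F1_reg_half[of a "1 + b - a", unfolded e] P_def pw by (simp only: mult_ac)
  qed
  have 4: "2 powr (- a) * hyp2F1_reg a (1 - a) (b - a) (1/2) =
      2 powr (1 - b) * P * rGamma (b / 2) * rGamma ((\<nu> - \<mu> + 1) / 2)"
  proof -
    have e: "(b - a + a) / 2 = b / 2" "(b - a + 1 - a) / 2 = (\<nu> - \<mu> + 1) / 2"
      by (simp_all add: a_def b_def field_simps)
    have pw: "(2 powr (1 - b) :: complex) = 2 powr (- a) * 2 powr (1 - (b - a))"
      by (simp flip: powr_add)
    show ?thesis unfolding hyp2F1_reg_half[of a "b - a", unfolded e] P_def pw by (simp only: mult_ac)
  qed
  have C: "C * (2 * \<i> * X * (Y * P * Z * W)) = 2 * (2 powr \<mu> * 2 powr \<mu>) * Y * (Gamma b * Z * X) * W" for X Y Z W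
    unfolding C_def P_def[symmetric] using P by (simp add: field_simps)
  have p: "2 * 2 powr (- b) * 2 powr (b - 1) = (1 :: complex)" "2 powr (1 - b) * 2 powr (b - 1) = (1 :: complex)"
    by (simp_all add: powr_diff powr_minus field_simps)
  have "C * (fourier_solution a b (of_real (pi / 2)) - fourier_solution a b (- of_real (pi / 2))) =
     2 * (2 powr \<mu> * 2 powr \<mu>) * 2 powr (- b) * (2 powr (b - 1) * P * rGamma (1 - b / 2)) * rGamma ((\<nu> - \<mu>) / 2 + 1)"
    unfolding fourier_solution_at_half_pi 3 C Gamma_times_trig_half(1)[OF b] P_def[symmetric] ..
  also have "\<dots> = (2 * 2 powr (- b) * 2 powr (b - 1)) *
     (2 powr \<mu> * (2 powr \<mu> * P * rGamma (1 - b / 2) * rGamma ((\<nu> - \<mu>) / 2 + 1)))"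
    by (simp only: mult_ac)
  finally show "half_angle_solution \<nu> \<mu> (of_real (pi / 2)) =
      C * (fourier_solution a b (of_real (pi / 2)) - fourier_solution a b (- of_real (pi / 2)))"
    unfolding half_angle_solution_at_half_pi 1 p by simp
  have "C * (fourier_solution' a b (of_real (pi / 2)) + fourier_solution' a b (- of_real (pi / 2))) =
     2 * (2 powr \<mu> * 2 powr \<mu>) * 2 powr (1 - b) * (2 powr (b - 1) * P * rGamma ((1 - b) / 2)) * rGamma ((\<nu> - \<mu> + 1) / 2)"
    unfolding fourier_solution_at_half_pi 4 C Gamma_times_trig_half(2)[OF b] P_def[symmetric] ..
  also have "\<dots> = (2 powr (1 - b) * 2 powr (b - 1)) *
     (2 powr \<mu> * (2 * 2 powr \<mu> * P * rGamma ((1 - b) / 2) * rGamma ((\<nu> - \<mu> + 1) / 2)))"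
    by (simp only: mult_ac)
  finally show "half_angle_solution' \<nu> \<mu> (of_real (pi / 2)) =
      C * (fourier_solution' a b (of_real (pi / 2)) + fourier_solution' a b (- of_real (pi / 2)))"
    unfolding half_angle_solution_at_half_pi 2 p by simp
qed

text \<open>
  Two solutions of one linear equation of second order, on a connected strip, with equal initial values.
\<close>

lemma half_angle_eq_fourier:
  fixes \<nu> \<mu> \<theta> :: complex
  assumes b: "\<nu> + \<mu> + 1 \<notin> \<int>\<^sub>\<le>\<^sub>0" and \<theta>: "0 < Re \<theta>" "Re \<theta> < pi"
  shows "half_angle_solution \<nu> \<mu> \<theta> =
    2 powr \<mu> * 2 powr \<mu> / (\<i> * of_real (sqrt pi)) * Gamma (\<nu> + \<mu> + 1) *
      (fourier_solution (\<mu> + 1/2) (\<nu> + \<mu> + 1) \<theta> - fourier_solution (\<mu> + 1/2) (\<nu> + \<mu> + 1) (- \<theta>))"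
proof -
  define a b where "a = \<mu> + 1 / 2" and "b = \<nu> + \<mu> + 1"
  define C where "C = 2 powr \<mu> * 2 powr \<mu> / (\<i> * of_real (sqrt pi)) * Gamma b"
  define S where "S = {z :: complex. 0 < Re z \<and> Re z < pi}"
  define p q where "p = (\<lambda>z::complex. - (2 * \<mu> + 1) * cos z / sin z)" and "q = - (\<nu> + \<mu> + 1) * (\<nu> - \<mu>)"
  have sinRe: "sin (Re z) \<noteq> 0" if "z \<in> S" for z
  proof -
    have "sin (Re z) > 0" using that by (intro sin_gt_zero) (simp_all add: S_def)
    thus ?thesis by simp
  qed
  have sin: "sin z \<noteq> 0" if "z \<in> S" for z
  proof -
    have "Re (sin z) > 0" using that by (intro Re_sin_pos) (simp_all add: S_def)
    thus ?thesis by auto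
  qed
  have pq: "- 2 * a * cos z / sin z = p z" "- b * (b - 2 * a) = q" for z
    by (simp_all add: a_def b_def p_def q_def algebra_simps)
  have S: "S = {z. 0 < Re z} \<inter> {z. Re z < pi}" by (auto simp: S_def)
  have "half_angle_solution \<nu> \<mu> \<theta> = (\<lambda>z. C * (fourier_solution a b z - fourier_solution a b (- z))) \<theta>"
  proof (rule linear_ode2_unique[where S = S and p = p and q = "\<lambda>_. q" and t = "of_real (pi / 2)"
        and f' = "half_angle_solution' \<nu> \<mu>"
        and f'' = "\<lambda>z. p z * half_angle_solution' \<nu> \<mu> z + q * half_angle_solution \<nu> \<mu> z"
        and g = "\<lambda>z. C * (fourier_solution a b z - fourier_solution a b (- z))"
        and g' = "\<lambda>z. C * (fourier_solution' a b z + fourier_solution' a b (- z))"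
        and g'' = "\<lambda>z. p z * (C * (fourier_solution' a b z + fourier_solution' a b (- z))) +
                        q * (C * (fourier_solution a b z - fourier_solution a b (- z)))"])
    show "open S" unfolding S by (intro open_Int open_halfspace_Re_gt open_halfspace_Re_lt)
    show "connected S" unfolding S
      by (intro convex_connected convex_Int convex_halfspace_Re_gt convex_halfspace_Re_lt)
    show "p holomorphic_on S" unfolding p_def using sin by (intro holomorphic_intros) auto
    show "(\<lambda>_. q) holomorphic_on S" by simp
  next
    fix z assume z: "z \<in> S"
    hence z': "0 < Re z" "Re z < pi" by (auto simp: S_def)
    show "(half_angle_solution \<nu> \<mu> has_field_derivative half_angle_solution' \<nu> \<mu> z) (at z)"
      by (rule half_angle_solution_derivs(1)[OF z'])
    show "(half_angle_solution' \<nu> \<mu> has_field_derivative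
        p z * half_angle_solution' \<nu> \<mu> z + q * half_angle_solution \<nu> \<mu> z) (at z)"
      unfolding p_def q_def by (rule half_angle_solution_derivs(2)[OF z'])
    have neg: "sin (Re (- z)) \<noteq> 0" "sin (- z) \<noteq> 0" using sinRe[OF z] sin[OF z] by simp_all
    have m: "((\<lambda>z. - z) has_field_derivative - 1) (at z)" by (auto intro!: derivative_eq_intros)
    note d = fourier_solution_derivs[OF sinRe[OF z] sin[OF z], of a b, unfolded pq]
    note d' = DERIV_chain2[OF fourier_solution_derivs(1)[OF neg, of a b] m]
              DERIV_chain2[OF fourier_solution_derivs(2)[OF neg, of a b, unfolded pq] m]
    show "((\<lambda>z. C * (fourier_solution a b z - fourier_solution a b (- z))) has_field_derivative
        C * (fourier_solution' a b z + fourier_solution' a b (- z))) (at z)"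
      by (rule DERIV_cong[OF DERIV_cmult[OF DERIV_diff[OF d(1) d'(1)]]]) simp
    show "((\<lambda>z. C * (fourier_solution' a b z + fourier_solution' a b (- z))) has_field_derivative
        p z * (C * (fourier_solution' a b z + fourier_solution' a b (- z))) +
        q * (C * (fourier_solution a b z - fourier_solution a b (- z)))) (at z)"
    proof (rule DERIV_cong[OF DERIV_cmult[OF DERIV_add[OF d(2) d'(2)]]])
      \<comment> \<open>The cotangent is odd, so reflection preserves the equation.\<close>
      have "p (- z) = - p z" by (simp add: p_def)
      thus "C * (p z * fourier_solution' a b z + q * fourier_solution a b z +
              (p (- z) * fourier_solution' a b (- z) + q * fourier_solution a b (- z)) * - 1) =
            p z * (C * (fourier_solution' a b z + fourier_solution' a b (- z))) +
            q * (C * (fourier_solution a b z - fourier_solution a b (- z)))"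
        by (simp only:) (simp add: algebra_simps)
    qed
  next
    show "of_real (pi / 2) \<in> S" by (simp add: S_def)
    show "\<theta> \<in> S" using \<theta> by (simp add: S_def)
    show "half_angle_solution \<nu> \<mu> (of_real (pi / 2)) =
        C * (fourier_solution a b (of_real (pi / 2)) - fourier_solution a b (- of_real (pi / 2)))"
      "half_angle_solution' \<nu> \<mu> (of_real (pi / 2)) =
        C * (fourier_solution' a b (of_real (pi / 2)) + fourier_solution' a b (- of_real (pi / 2)))"
      unfolding C_def a_def b_def by (rule solutions_agree_at_half_pi[OF b])+
  qed simp_all
  thus ?thesis by (simp only: C_def a_def b_def)
qed

section \<open>The Ferrers function\<close>

text \<open>
  The arguments of two points of the right half-plane add up to less than \<open>\<pi>\<close> in absolute value. This and
  \<open>square_powr_half\<close> settle all questions of branches in passing from \<open>x\<close> to \<open>\<theta>\<close>.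
\<close>

lemma Ln_mult_right_half_plane:
  assumes "Re y > 0" "Re z > 0"
  shows "Ln (y * z) = Ln y + Ln z"
proof (rule Ln_times_simple)
  have "\<bar>Im (Ln y)\<bar> < pi / 2" "\<bar>Im (Ln z)\<bar> < pi / 2"
    by (rule Re_Ln_pos_lt_imp, fact)+
  thus "- pi < Im (Ln y) + Im (Ln z)" "Im (Ln y) + Im (Ln z) \<le> pi" by linarith+
qed (use assms in auto)

lemma square_powr_half:
  assumes "Re z > 0"
  shows "(z\<^sup>2) powr (\<mu> / 2) = exp (\<mu> * Ln z)"
proof -
  have "z \<noteq> 0" using assms by auto
  have "Ln (z\<^sup>2) = 2 * Ln z"
    using Ln_mult_right_half_plane[OF assms assms] by (simp add: power2_eq_square)
  thus ?thesis using \<open>z \<noteq> 0\<close> by (simp add: powr_def)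
qed

text \<open>
  With \<open>s = sin (\<theta>/2)\<close> and \<open>k = cos (\<theta>/2)\<close> one has \<open>(1 + x)/(1 - x) = (k/s)\<^sup>2\<close> and \<open>1 - x\<^sup>2 = (2 s k)\<^sup>2\<close>, where all of
  \<open>s\<close>, \<open>k\<close>, \<open>k/s\<close> and \<open>2 s k\<close> lie in the right half-plane; so the principal powers behave as for positive reals.
\<close>

lemma ferrersP_cos:
  assumes \<theta>: "0 < Re \<theta>" "Re \<theta> < pi"
  shows "ferrersP \<nu> \<mu> (cos \<theta>) =
    2 powr (- \<mu>) * (1 - (cos \<theta>)\<^sup>2) powr (\<mu> / 2) * half_angle_solution \<nu> \<mu> \<theta>"
proof -
  define s k where "s = sin (\<theta> / 2)" and "k = cos (\<theta> / 2)"
  have pos: "Re s > 0" "Re k > 0"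
    unfolding s_def k_def using \<theta> by (intro Re_sin_pos Re_cos_pos; simp)+
  hence nz: "s \<noteq> 0" "k \<noteq> 0" by auto
  have cos: "1 - cos \<theta> = 2 * s\<^sup>2" "1 + cos \<theta> = 2 * k\<^sup>2"
    using cos_double_sin[of "\<theta> / 2"] cos_double_cos[of "\<theta> / 2"] by (simp_all add: s_def k_def)
  have sin: "sin \<theta> = 2 * (s * k)"
    using sin_double[of "\<theta> / 2"] by (simp add: s_def k_def mult.assoc)
  have "Re (sin \<theta>) > 0" using \<theta> by (rule Re_sin_pos)
  \<comment> \<open>The cotangent of a point with real part in \<open>(0, \<pi>/2)\<close> has positive real part.\<close>
  have "Re (k / s) > 0"
  proof -
    define A P Q where "A = Re (\<theta> / 2)" and "P = exp (Im (\<theta> / 2))" and "Q = exp (- Im (\<theta> / 2))"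
    have PQ: "P * Q = 1" by (simp add: P_def Q_def flip: exp_add)
    have "Re (k * cnj s) = Re k * Re s + Im k * Im s" by simp
    also have "\<dots> = sin A * cos A * (P * Q)"
      unfolding s_def k_def Re_sin Re_cos Im_sin Im_cos A_def[symmetric] P_def[symmetric] Q_def[symmetric]
      by (simp add: field_simps)
    also have "\<dots> = sin (Re \<theta>) / 2"
      using sin_double[of A] by (simp add: PQ A_def)
    finally have "Re (k * cnj s) = sin (Re \<theta>) / 2" .
    moreover have "sin (Re \<theta>) > 0" using \<theta> by (rule sin_gt_zero)
    ultimately have "Re (k * cnj s) > 0" by simp
    thus ?thesis using nz by (simp add: complex_div_cnj[of k s] Re_divide_of_real flip: of_real_power)
  qed
  have "Ln k = Ln (k / s) + Ln s"
    using Ln_mult_right_half_plane[OF \<open>Re (k / s) > 0\<close> pos(1)] nz by simp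
  moreover have "Ln (sin \<theta>) = Ln 2 + (Ln s + Ln k)"
  proof -
    have "Ln (s * k) = Ln s + Ln k" by (rule Ln_mult_right_half_plane[OF pos])
    moreover have "Re (s * k) > 0" using \<open>Re (sin \<theta>) > 0\<close> unfolding sin by simp
    ultimately show ?thesis unfolding sin using Ln_mult_right_half_plane[of 2 "s * k"] by simp
  qed
  ultimately have "\<mu> * Ln (k / s) = \<mu> * Ln (sin \<theta>) + - \<mu> * Ln 2 + - 2 * \<mu> * Ln s"
    by (simp add: algebra_simps)
  hence E: "exp (\<mu> * Ln (k / s)) = exp (\<mu> * Ln (sin \<theta>)) * 2 powr (- \<mu>) * exp (- 2 * \<mu> * Ln s)"
    by (simp only: exp_add powr_def) simp
  have "(1 + cos \<theta>) / (1 - cos \<theta>) = (k / s)\<^sup>2"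
    unfolding cos by (simp add: power_divide)
  hence 1: "((1 + cos \<theta>) / (1 - cos \<theta>)) powr (\<mu> / 2) = exp (\<mu> * Ln (k / s))"
    using square_powr_half[OF \<open>Re (k / s) > 0\<close>] by simp
  have "1 - (cos \<theta>)\<^sup>2 = (sin \<theta>)\<^sup>2" by (simp add: sin_squared_eq)
  hence 2: "(1 - (cos \<theta>)\<^sup>2) powr (\<mu> / 2) = exp (\<mu> * Ln (sin \<theta>))"
    using square_powr_half[OF \<open>Re (sin \<theta>) > 0\<close>] by simp
  have 3: "(1 - cos \<theta>) / 2 = s\<^sup>2" unfolding cos by simp
  show ?thesis
    unfolding ferrersP_def half_angle_solution_def 1 2 3 E s_def[symmetric] by (simp only: mult_ac)
qed

text \<open>
  Since \<open>u * v = 1\<close> and \<open>u + v = 2 x\<close>, the angle is \<open>\<theta> = - \<i> Ln u\<close>. It lies in the open strip exactly when \<open>u\<close> lies in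
  the upper half-plane: the choice of the square root gives \<open>Im u \<ge> Im v\<close>, hence \<open>Im u \<ge> 0\<close> because
  the imaginary parts of \<open>u\<close> and \<open>v = 1/u\<close> have opposite signs, and a real \<open>u\<close> would
  make \<open>x\<close> real with \<open>\<bar>x\<bar> \<ge> 1\<close>.
\<close>

lemma cos_parametrisation:
  fixes x u v :: complex
  assumes x: "x \<notin> complex_of_real ` ({..-1} \<union> {1..})"
    and u: "u = x + \<i> * csqrt (1 - x\<^sup>2)"
    and v: "v = x - \<i> * csqrt (1 - x\<^sup>2)"
  obtains \<theta> where "0 < Re \<theta>" "Re \<theta> < pi" "x = cos \<theta>" "u = exp (\<i> * \<theta>)" "v = exp (- (\<i> * \<theta>))"
proof -
  have "u * v = x\<^sup>2 + (csqrt (1 - x\<^sup>2))\<^sup>2"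
    by (simp add: u v algebra_simps power2_eq_square)
  hence uv: "u * v = 1" by simp
  hence nz: "u \<noteq> 0" "v \<noteq> 0" by auto
  have v': "v = inverse u" using uv nz by (simp add: field_simps)
  have xuv: "2 * x = u + v" by (simp add: u v)
  have "Im u \<noteq> 0"
  proof
    assume "Im u = 0"
    define r where "r = Re u"
    have ur: "u = of_real r" using \<open>Im u = 0\<close> by (simp add: r_def complex_eq_iff)
    have "r \<noteq> 0" using nz ur by auto
    have "2 * x = of_real (r + 1 / r)" unfolding xuv v' ur by (simp add: divide_inverse)
    hence xr: "x = of_real ((r + 1 / r) / 2)" by (simp add: field_simps)
    \<comment> \<open>The inequality \<open>\<bar>r + 1/r\<bar> \<ge> 2\<close>.\<close>
    have sq: "(r + 1 / r)\<^sup>2 = (r - 1 / r)\<^sup>2 + 2\<^sup>2"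
      using \<open>r \<noteq> 0\<close> by (simp add: power2_eq_square field_simps)
    hence "2\<^sup>2 \<le> (r + 1 / r)\<^sup>2" using zero_le_power2[of "r - 1 / r"] by linarith
    hence "\<bar>2\<bar> \<le> \<bar>r + 1 / r\<bar>" by (simp only: abs_le_square_iff)
    hence "(r + 1 / r) / 2 \<in> {..-1} \<union> {1..}" by (cases "r + 1 / r \<ge> 0") simp_all
    thus False using x unfolding xr by blast
  qed
  moreover have "Im u \<ge> 0"
  proof (rule ccontr)
    assume "\<not> Im u \<ge> 0"
    hence neg: "Im u < 0" by simp
    have "Im v = - Im u / (cmod u)\<^sup>2"
      unfolding v' by (simp add: cmod_power2)
    also have "\<dots> > 0" using neg nz by (simp add: divide_neg_pos)
    finally have "Im v > 0" .
    moreover have "Im u - Im v = 2 * Re (csqrt (1 - x\<^sup>2))" by (simp add: u v)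
    moreover have "Re (csqrt (1 - x\<^sup>2)) \<ge> 0" by (rule Re_csqrt)
    ultimately show False using neg by linarith
  qed
  ultimately have "0 < Im (Ln u)" "Im (Ln u) < pi"
    using Im_Ln_pos_lt_imp[of u] by auto
  moreover define \<theta> where "\<theta> = - \<i> * Ln u"
  moreover have eu: "exp (\<i> * \<theta>) = u" using nz by (simp add: \<theta>_def flip: mult.assoc)
  moreover have ev: "exp (- (\<i> * \<theta>)) = v" using eu by (simp add: exp_minus v')
  moreover have "x = cos \<theta>"
    unfolding cos_exp_eq eu ev using xuv by (simp add: field_simps)
  ultimately show ?thesis by (intro that[of \<theta>]) simp_all
qed

theorem theorem1:
  fixes x \<nu> \<mu> u v :: complex
  assumes x: "x \<notin> complex_of_real ` ({..-1} \<union> {1..})"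
    and \<nu>\<mu>: "\<And>n::nat. n \<ge> 1 \<Longrightarrow> \<nu> + \<mu> \<noteq> - of_nat n"
    and u: "u = x + \<i> * csqrt (1 - x\<^sup>2)"
    and v: "v = x - \<i> * csqrt (1 - x\<^sup>2)"
  shows "v = 1 / u \<and>
    ferrersP \<nu> \<mu> x =
      2 powr \<mu> / (\<i> * complex_of_real (sqrt pi)) * (1 - x\<^sup>2) powr (\<mu> / 2) * Gamma (\<nu> + \<mu> + 1) *
      (u powr (\<nu> + \<mu> + 1) * hyp2F1_reg (\<mu> + 1/2) (\<nu> + \<mu> + 1) (\<nu> + 3/2) (u / v) -
       v powr (\<nu> + \<mu> + 1) * hyp2F1_reg (\<mu> + 1/2) (\<nu> + \<mu> + 1) (\<nu> + 3/2) (v / u))"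
proof
  obtain \<theta> where \<theta>: "0 < Re \<theta>" "Re \<theta> < pi" and cos: "x = cos \<theta>"
    and ue: "u = exp (\<i> * \<theta>)" and ve: "v = exp (- (\<i> * \<theta>))"
    using cos_parametrisation[OF x u v] .
  show "v = 1 / u"
    unfolding ue ve by (simp add: exp_minus divide_inverse)
  define b where "b = \<nu> + \<mu> + 1"
  have b: "\<nu> + \<mu> + 1 \<notin> \<int>\<^sub>\<le>\<^sub>0"
  proof
    assume "\<nu> + \<mu> + 1 \<in> \<int>\<^sub>\<le>\<^sub>0"
    then obtain n where "\<nu> + \<mu> + 1 = - of_nat n" by (auto elim!: nonpos_Ints_cases')
    hence "\<nu> + \<mu> = - of_nat n - 1" by (simp only: eq_diff_eq)
    hence "\<nu> + \<mu> = - of_nat (n + 1)" by simp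
    thus False using \<nu>\<mu>[of "n + 1"] by simp
  qed
  have pw: "u powr b = exp (\<i> * b * \<theta>)" "v powr b = exp (\<i> * b * - \<theta>)"
    using \<theta> by (simp_all add: ue ve powr_def mult_ac)
  have quot: "u / v = exp (2 * \<i> * \<theta>)" "v / u = exp (2 * \<i> * - \<theta>)"
    unfolding ue ve by (simp_all add: mult.assoc flip: exp_diff)
  have c: "1 + b - (\<mu> + 1/2) = \<nu> + 3/2" by (simp add: b_def)
  have four: "fourier_solution (\<mu> + 1/2) b \<theta> = u powr b * hyp2F1_reg (\<mu> + 1/2) b (\<nu> + 3/2) (u / v)"
    "fourier_solution (\<mu> + 1/2) b (- \<theta>) = v powr b * hyp2F1_reg (\<mu> + 1/2) b (\<nu> + 3/2) (v / u)"
    unfolding fourier_solution_def c pw quot by (rule refl)+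
  have half: "half_angle_solution \<nu> \<mu> \<theta> =
    2 powr \<mu> * 2 powr \<mu> / (\<i> * of_real (sqrt pi)) * Gamma b *
      (u powr b * hyp2F1_reg (\<mu> + 1/2) b (\<nu> + 3/2) (u / v) - v powr b * hyp2F1_reg (\<mu> + 1/2) b (\<nu> + 3/2) (v / u))"
    using half_angle_eq_fourier[OF b \<theta>] unfolding b_def[symmetric] four .
  have p: "2 powr (- \<mu>) * (2 powr \<mu> * 2 powr \<mu>) = (2 powr \<mu> :: complex)"
    by (simp flip: powr_add)
  have const: "2 powr (- \<mu>) * W * (2 powr \<mu> * 2 powr \<mu> / R * G * D) = 2 powr \<mu> / R * W * G * D" for W R G D :: complex
  proof -
    have const: "2 powr (- \<mu>) * W * (2 powr \<mu> * 2 powr \<mu> / R * G * D) =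
        (2 powr (- \<mu>) * (2 powr \<mu> * 2 powr \<mu>)) / R * W * G * D"
      by (simp only: divide_inverse mult_ac)
    thus ?thesis unfolding p .
  qed
  show "ferrersP \<nu> \<mu> x =
      2 powr \<mu> / (\<i> * complex_of_real (sqrt pi)) * (1 - x\<^sup>2) powr (\<mu> / 2) * Gamma (\<nu> + \<mu> + 1) *
      (u powr (\<nu> + \<mu> + 1) * hyp2F1_reg (\<mu> + 1/2) (\<nu> + \<mu> + 1) (\<nu> + 3/2) (u / v) -
       v powr (\<nu> + \<mu> + 1) * hyp2F1_reg (\<mu> + 1/2) (\<nu> + \<mu> + 1) (\<nu> + 3/2) (v / u))"
    using ferrersP_cos[OF \<theta>, of \<nu> \<mu>] unfolding cos[symmetric] half b_def[symmetric] const .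
qed

end
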